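(* Let $p$ be a prime, $1\le r\le q<\infty$ and $0\le\beta<1-\frac1q$. Let $$\mathscr{H}^pf(x)=\frac{1}{|x|_p}\int_{|y|_p\le|x|_p}f(y)\,dy,\qquad x\in\mathbb{Q}_p^*,$$ be the $p$-adic Hardy operator. Then, for any $f\in C^{\beta}M_{r,q}(\mathbb{Q}_p)$, $$\|\mathscr{H}^pf\|_{C^{\beta}M_{r,q}(\mathbb{Q}_p)}\le C_{p,\beta,q}\,\|f\|_{C^{\beta}M_{r,q}(\mathbb{Q}_p)},$$ where the constant $C_{p,\beta,q}$ is given by $$C_{p,\beta,q}=(1-p^{-1})\sum_{j\in\mathbb{Z}}\mathscr{K}(1,p^j)\,p^{j\left(1-\beta-\frac1q\right)},$$ with $\mathscr{K}(s,t)=s^{-1}$ if $0<t\le s$ and $\mathscr{K}(s,t)=0$ if $t>s>0$.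
   Context: $\mathbb{Q}_p$ is the field of $p$-adic numbers with the $p$-adic absolute value $|\cdot|_p$, $\mathbb{Q}_p^*=\mathbb{Q}_p\setminus\{0\}$, and $dx$ is the Haar measure on $(\mathbb{Q}_p,+)$ normalized so that $\{x:|x|_p\le 1\}$ has measure $1$; $|E|$ denotes the measure of $E$. For $a\in\mathbb{Q}_p$, $\ell\in\mathbb{Z}$, let $B^\ell(a)=\{x\in\mathbb{Q}_p:|x-a|_p\le p^\ell\}$, so $|B^\ell(a)|=p^\ell$. For $1\le r\le q<\infty$ and $0\le\beta<1$, the fractional Cesàro–Morrey space $C^{\beta}M_{r,q}(\mathbb{Q}_p)$ consists of all locally integrable functions $f$ on $\mathbb{Q}_p$ with $\|f\|_{C^{\beta}M_{r,q}(\mathbb{Q}_p)}<\infty$, where for measurable $f$ (with values in $[0,\infty]$) $$\|f\|_{C^{\beta}M_{r,q}(\mathbb{Q}_p)}=\sup_{a\in\mathbb{Q}_p,\ \ell\in\mathbb{Z}}|B^\ell(a)|^{\frac1q-\frac1r}\left(\int_{B^\ell(a)}\left(\frac{1}{|x|_p^{1-\beta}}\int_{|t|_p\le|x|_p}|f(t)|\,dt\right)^r dx\right)^{1/r}.$$ *)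

theory Defs
  imports "HOL-Analysis.Analysis" "Berlekamp_Zassenhaus.Finite_Field"
begin

section \<open>The \<open>p\<close>-adic absolute value on the rationals\<close>

definition padic_abs_rat :: "nat \<Rightarrow> rat \<Rightarrow> real" where
  "padic_abs_rat p x =
     (if x = 0 then 0
      else real p powi (int (multiplicity (int p) (snd (quotient_of x)))
                        - int (multiplicity (int p) (fst (quotient_of x)))))"

definition padic_Cauchy :: "nat \<Rightarrow> (nat \<Rightarrow> rat) \<Rightarrow> bool" where
  "padic_Cauchy p X \<longleftrightarrow>
     (\<forall>e>0. \<exists>k. \<forall>m\<ge>k. \<forall>n\<ge>k. padic_abs_rat p (X m - X n) < e)"

definition padic_null :: "nat \<Rightarrow> (nat \<Rightarrow> rat) \<Rightarrow> bool" where
  "padic_null p X \<longleftrightarrow> (\<lambda>n. padic_abs_rat p (X n)) \<longlonglongrightarrow> 0"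

definition padic_rel :: "nat \<Rightarrow> (nat \<Rightarrow> rat) \<Rightarrow> (nat \<Rightarrow> rat) \<Rightarrow> bool" where
  "padic_rel p X Y \<longleftrightarrow>
     padic_Cauchy p X \<and> padic_Cauchy p Y \<and> padic_null p (\<lambda>n. X n - Y n)"

lemma padic_abs_rat_0 [simp]: "padic_abs_rat p 0 = 0"
  by (simp add: padic_abs_rat_def)

lemma padic_Cauchy_const [simp]: "padic_Cauchy p (\<lambda>n. c)"
  by (simp add: padic_Cauchy_def)

lemma padic_null_0 [simp]: "padic_null p (\<lambda>n. 0)"
  by (simp add: padic_null_def)

context
  fixes p :: nat
  assumes prime_p: "prime p"
begin

private abbreviation (input) N :: "rat \<Rightarrow> real" where "N \<equiv> padic_abs_rat p"

lemma padic_abs_rat_Fract: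
  assumes "a \<noteq> 0" "b \<noteq> 0"
  shows "N (Rat.Fract a b) = real p powi (int (multiplicity (int p) b) - int (multiplicity (int p) a))"
proof -
  obtain c d where cd: "quotient_of (Rat.Fract a b) = (c, d)" by force
  have d: "d > 0" using cd by (metis quotient_of_denom_pos)
  have eq: "Rat.Fract a b = Rat.Fract c d"
    using cd d by (metis quotient_of_div Fract_of_int_quotient)
  have ad: "a * d = c * b" using eq assms d by (simp add: eq_rat)
  have c: "c \<noteq> 0" using ad assms d by auto
  have P: "prime_elem (int p)" using prime_p by auto
  have "multiplicity (int p) (a * d) = multiplicity (int p) (c * b)" using ad by simp
  hence "multiplicity (int p) a + multiplicity (int p) d = multiplicity (int p) c + multiplicity (int p) b"
    using P assms c d by (simp add: prime_elem_multiplicity_mult_distrib)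
  moreover have "Rat.Fract a b \<noteq> 0" using assms by (simp add: Zero_rat_def eq_rat)
  ultimately show ?thesis unfolding padic_abs_rat_def cd by simp (rule arg_cong, linarith)
qed

lemma padic_abs_rat_nonneg [simp]: "0 \<le> N x"
  by (simp add: padic_abs_rat_def)

lemma padic_abs_rat_eq_0 [simp]: "N x = 0 \<longleftrightarrow> x = 0"
  using prime_gt_0_nat[OF prime_p] by (simp add: padic_abs_rat_def)

lemma padic_abs_rat_1 [simp]: "N 1 = 1"
  by (simp add: padic_abs_rat_def)

lemma padic_abs_rat_mult: "N (x * y) = N x * N y"
proof (cases "x = 0 \<or> y = 0")
  case False
  obtain a b where x: "x = Rat.Fract a b" "b \<noteq> 0" by (metis Rat_cases less_irrefl)
  obtain c d where y: "y = Rat.Fract c d" "d \<noteq> 0" by (metis Rat_cases less_irrefl)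
  have ac: "a \<noteq> 0" "c \<noteq> 0" using False x y by (auto simp: rat_number_collapse)
  have P: "prime_elem (int p)" using prime_p by auto
  have p0: "real p \<noteq> 0" using prime_gt_0_nat[OF prime_p] by simp
  show ?thesis using x y ac P p0
    by (simp add: padic_abs_rat_Fract prime_elem_multiplicity_mult_distrib
        flip: power_int_add) (simp add: algebra_simps)
qed auto

lemma padic_abs_rat_minus [simp]: "N (- x) = N x"
proof -
  have "N (- 1) * N (- 1) = 1" by (simp flip: padic_abs_rat_mult)
  hence "N (- 1) = 1"
    by (metis abs_of_nonneg padic_abs_rat_nonneg real_sqrt_abs2 real_sqrt_one)
  thus ?thesis using padic_abs_rat_mult[of "- 1" x] by simp
qed

lemma padic_abs_rat_diff_commute: "N (x - y) = N (y - x)"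
  by (metis minus_diff_eq padic_abs_rat_minus)

lemma padic_abs_rat_add: "N (x + y) \<le> max (N x) (N y)"
proof (cases "x = 0 \<or> y = 0 \<or> x + y = 0")
  case False
  obtain a b where x: "x = Rat.Fract a b" "b \<noteq> 0" by (metis Rat_cases less_irrefl)
  obtain c d where y: "y = Rat.Fract c d" "d \<noteq> 0" by (metis Rat_cases less_irrefl)
  define u v w where "u = a * d" and "v = c * b" and "w = b * d"
  have w: "w \<noteq> 0" using x y by (simp add: w_def)
  have xu: "x = Rat.Fract u w" and yv: "y = Rat.Fract v w"
    using x y by (simp_all add: u_def v_def w_def eq_rat)
  have xy: "x + y = Rat.Fract (u + v) w"
    using w unfolding xu yv by (simp add: eq_rat algebra_simps)
  have nz: "u \<noteq> 0" "v \<noteq> 0" "u + v \<noteq> 0"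
    using False xu yv xy by (auto simp: rat_number_collapse)
  let ?m = "multiplicity (int p)"
  have P: "prime_elem (int p)" using prime_p by auto
  have "int p ^ min (?m u) (?m v) dvd u + v"
    by (intro dvd_add) (simp_all add: multiplicity_dvd')
  hence m: "min (?m u) (?m v) \<le> ?m (u + v)"
    using nz P by (intro multiplicity_geI) auto
  have Nxy: "N (x + y) = real p powi (int (?m w) - int (?m (u + v)))"
    and Nx: "N x = real p powi (int (?m w) - int (?m u))"
    and Ny: "N y = real p powi (int (?m w) - int (?m v))"
    using nz w unfolding xy by (simp_all add: xu yv padic_abs_rat_Fract)
  have p1: "real p \<ge> 1" using prime_gt_0_nat[OF prime_p] by simp
  show ?thesis
  proof (cases "?m u \<le> ?m v")
    case True
    hence "N (x + y) \<le> N x"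
      unfolding Nxy Nx using m p1 by (auto intro!: power_int_increasing)
    thus ?thesis by simp
  next
    case False
    hence "N (x + y) \<le> N y"
      unfolding Nxy Ny using m p1 by (auto intro!: power_int_increasing)
    thus ?thesis by simp
  qed
qed (auto simp: le_max_iff_disj)

lemma padic_abs_rat_triangle: "N (x + y) \<le> N x + N y"
  using padic_abs_rat_add[of x y] padic_abs_rat_nonneg[of x] padic_abs_rat_nonneg[of y]
  by linarith

lemma padic_abs_rat_reverse_triangle: "\<bar>N x - N y\<bar> \<le> N (x - y)"
  using padic_abs_rat_triangle[of "x - y" y] padic_abs_rat_triangle[of "y - x" x]
    padic_abs_rat_diff_commute[of x y] by simp

lemma padic_abs_rat_inverse: "N (inverse x) = inverse (N x)"
proof (cases "x = 0")
  case False
  hence "N x * N (inverse x) = 1" by (simp flip: padic_abs_rat_mult)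
  thus ?thesis by (metis inverse_unique)
qed auto

lemma padic_CauchyD:
  "padic_Cauchy p X \<Longrightarrow> e > 0 \<Longrightarrow> \<exists>k. \<forall>m\<ge>k. \<forall>n\<ge>k. N (X m - X n) < e"
  by (auto simp: padic_Cauchy_def)

lemma padic_Cauchy_add:
  assumes "padic_Cauchy p X" "padic_Cauchy p Y"
  shows "padic_Cauchy p (\<lambda>n. X n + Y n)"
  unfolding padic_Cauchy_def
proof (intro allI impI)
  fix e :: real assume e: "e > 0"
  obtain k where k: "\<forall>m\<ge>k. \<forall>n\<ge>k. N (X m - X n) < e" using padic_CauchyD[OF assms(1) e] ..
  obtain l where l: "\<forall>m\<ge>l. \<forall>n\<ge>l. N (Y m - Y n) < e" using padic_CauchyD[OF assms(2) e] ..
  have "N (X m + Y m - (X n + Y n)) < e" if "m \<ge> max k l" "n \<ge> max k l" for m n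
  proof -
    have "N (X m + Y m - (X n + Y n)) \<le> max (N (X m - X n)) (N (Y m - Y n))"
      unfolding add_diff_add by (rule padic_abs_rat_add)
    also have "\<dots> < e" using that k l by simp
    finally show ?thesis .
  qed
  thus "\<exists>k. \<forall>m\<ge>k. \<forall>n\<ge>k. N (X m + Y m - (X n + Y n)) < e" by blast
qed

lemma padic_Cauchy_minus: "padic_Cauchy p X \<Longrightarrow> padic_Cauchy p (\<lambda>n. - X n)"
  unfolding padic_Cauchy_def minus_diff_minus padic_abs_rat_minus .

lemma padic_Cauchy_diff:
  "padic_Cauchy p X \<Longrightarrow> padic_Cauchy p Y \<Longrightarrow> padic_Cauchy p (\<lambda>n. X n - Y n)"
  using padic_Cauchy_add[OF _ padic_Cauchy_minus, of X Y] by simp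

lemma padic_Cauchy_convergent:
  assumes "padic_Cauchy p X"
  shows "convergent (\<lambda>n. N (X n))"
proof -
  have "Cauchy (\<lambda>n. N (X n))"
    unfolding Cauchy_def dist_real_def
    using assms padic_abs_rat_reverse_triangle unfolding padic_Cauchy_def
    by (meson le_less_trans)
  thus ?thesis by (rule Cauchy_convergent)
qed

lemma padic_Cauchy_bounded:
  assumes "padic_Cauchy p X"
  obtains b where "b > 0" "\<And>n. N (X n) \<le> b"
proof -
  have "Bseq (\<lambda>n. N (X n))" using padic_Cauchy_convergent[OF assms] by (rule convergent_imp_Bseq)
  then obtain b where "b > 0" "\<And>n. norm (N (X n)) \<le> b" by (auto elim: BseqE)
  thus ?thesis using that by simp
qed

lemma padic_null_add: "padic_null p X \<Longrightarrow> padic_null p Y \<Longrightarrow> padic_null p (\<lambda>n. X n + Y n)"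
  unfolding padic_null_def
  by (rule real_tendsto_sandwich[where f = "\<lambda>_. 0" and h = "\<lambda>n. N (X n) + N (Y n)"])
     (auto intro!: tendsto_eq_intros simp: padic_abs_rat_triangle)

lemma padic_null_minus: "padic_null p (\<lambda>n. - X n) \<longleftrightarrow> padic_null p X"
  by (simp add: padic_null_def)

lemma padic_null_diff: "padic_null p X \<Longrightarrow> padic_null p Y \<Longrightarrow> padic_null p (\<lambda>n. X n - Y n)"
  using padic_null_add[of X "\<lambda>n. - Y n"] by (simp add: padic_null_minus)

lemma padic_null_mult:
  assumes "padic_Cauchy p X" "padic_null p Y"
  shows "padic_null p (\<lambda>n. X n * Y n)"
proof -
  obtain b where b: "b > 0" "\<And>n. N (X n) \<le> b" using padic_Cauchy_bounded[OF assms(1)] by blast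
  have "(\<lambda>n. b * N (Y n)) \<longlonglongrightarrow> 0"
    using tendsto_mult_left[of "\<lambda>n. N (Y n)" 0 sequentially b] assms(2)
    by (simp add: padic_null_def)
  thus ?thesis unfolding padic_null_def
    by (rule real_tendsto_sandwich[where f = "\<lambda>_. 0", rotated 3])
       (auto simp: padic_abs_rat_mult b intro!: always_eventually mult_right_mono)
qed

lemma padic_Cauchy_mult:
  assumes "padic_Cauchy p X" "padic_Cauchy p Y"
  shows "padic_Cauchy p (\<lambda>n. X n * Y n)"
  unfolding padic_Cauchy_def
proof (intro allI impI)
  fix e :: real assume e: "e > 0"
  obtain a where a: "a > 0" "\<And>n. N (X n) \<le> a" using padic_Cauchy_bounded[OF assms(1)] by blast
  obtain b where b: "b > 0" "\<And>n. N (Y n) \<le> b" using padic_Cauchy_bounded[OF assms(2)] by blast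
  obtain k where k: "\<forall>m\<ge>k. \<forall>n\<ge>k. N (X m - X n) < e / b"
    using padic_CauchyD[OF assms(1), of "e / b"] e b by auto
  obtain l where l: "\<forall>m\<ge>l. \<forall>n\<ge>l. N (Y m - Y n) < e / a"
    using padic_CauchyD[OF assms(2), of "e / a"] e a by auto
  have "N (X m * Y m - X n * Y n) < e" if "m \<ge> max k l" "n \<ge> max k l" for m n
  proof -
    have "N (X m) * N (Y m - Y n) \<le> a * N (Y m - Y n)" by (intro mult_right_mono a) simp
    also have "\<dots> < e" using l that a by (simp add: field_simps)
    finally have 1: "N (X m) * N (Y m - Y n) < e" .
    have "N (X m - X n) * N (Y n) \<le> N (X m - X n) * b" by (intro mult_left_mono b) simp
    also have "\<dots> < e" using k that b by (simp add: field_simps)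
    finally have 2: "N (X m - X n) * N (Y n) < e" .
    have "N (X m * Y m - X n * Y n) \<le> max (N (X m) * N (Y m - Y n)) (N (X m - X n) * N (Y n))"
      unfolding mult_diff_mult padic_abs_rat_mult[symmetric] by (rule padic_abs_rat_add)
    thus ?thesis using 1 2 by simp
  qed
  thus "\<exists>k. \<forall>m\<ge>k. \<forall>n\<ge>k. N (X m * Y m - X n * Y n) < e" by blast
qed

lemma padic_not_null:
  assumes "padic_Cauchy p X" "\<not> padic_null p X"
  obtains b k where "b > 0" "\<And>n. n \<ge> k \<Longrightarrow> N (X n) \<ge> b"
proof -
  obtain L where L: "(\<lambda>n. N (X n)) \<longlonglongrightarrow> L"
    using padic_Cauchy_convergent[OF assms(1)] by (auto simp: convergent_def)
  have "L \<ge> 0" using L by (rule LIMSEQ_le_const) simp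
  moreover have "L \<noteq> 0" using L assms(2) by (auto simp: padic_null_def)
  ultimately have "L / 2 < L" "L / 2 > 0" by auto
  then obtain k where "\<forall>n\<ge>k. L / 2 < N (X n)"
    using order_tendstoD(1)[OF L \<open>L / 2 < L\<close>] by (auto simp: eventually_sequentially)
  thus ?thesis using that[of "L / 2" k] \<open>L / 2 > 0\<close> by force
qed

lemma padic_Cauchy_inverse:
  assumes "padic_Cauchy p X" "\<not> padic_null p X"
  shows "padic_Cauchy p (\<lambda>n. inverse (X n))"
  unfolding padic_Cauchy_def
proof (intro allI impI)
  fix e :: real assume e: "e > 0"
  obtain b k where b: "b > 0" "\<And>n. n \<ge> k \<Longrightarrow> N (X n) \<ge> b"
    using padic_not_null[OF assms] by blast
  obtain l where l: "\<forall>m\<ge>l. \<forall>n\<ge>l. N (X m - X n) < b * b * e"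
    using padic_CauchyD[OF assms(1), of "b * b * e"] e b by auto
  have "N (inverse (X m) - inverse (X n)) < e" if mn: "m \<ge> max k l" "n \<ge> max k l" for m n
  proof -
    have bm: "b \<le> N (X m)" and bn: "b \<le> N (X n)" using b mn by auto
    hence nz: "X m \<noteq> 0" "X n \<noteq> 0" using b(1) by auto
    have "N (inverse (X m) - inverse (X n)) = N (X m - X n) / (N (X m) * N (X n))"
      unfolding inverse_diff_inverse[OF nz] padic_abs_rat_minus padic_abs_rat_mult
        padic_abs_rat_inverse by (simp add: field_simps)
    also have "\<dots> \<le> N (X m - X n) / (b * b)"
      using b(1) bm bn by (intro divide_left_mono mult_mono mult_pos_pos) auto
    also have "\<dots> < e" using l mn b(1) by (simp add: field_simps)
    finally show ?thesis .
  qed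
  thus "\<exists>k. \<forall>m\<ge>k. \<forall>n\<ge>k. N (inverse (X m) - inverse (X n)) < e" by blast
qed

lemma padic_null_mult_inverse:
  assumes "padic_Cauchy p X" "\<not> padic_null p X"
  shows "padic_null p (\<lambda>n. inverse (X n) * X n - 1)"
proof -
  obtain b k where b: "b > 0" "\<And>n. n \<ge> k \<Longrightarrow> N (X n) \<ge> b"
    using padic_not_null[OF assms] by blast
  have "\<forall>n\<ge>k. N (inverse (X n) * X n - 1) = 0"
  proof (intro allI impI)
    fix n assume "k \<le> n"
    hence "X n \<noteq> 0" using b(1) b(2)[of n] by auto
    thus "N (inverse (X n) * X n - 1) = 0" by simp
  qed
  thus ?thesis unfolding padic_null_def
    by (intro tendsto_eventually) (auto simp: eventually_sequentially)
qed

lemma padic_null_diff_inverse: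
  assumes "padic_Cauchy p X" "\<not> padic_null p X" "padic_Cauchy p Y" "\<not> padic_null p Y"
    "padic_null p (\<lambda>n. X n - Y n)"
  shows "padic_null p (\<lambda>n. inverse (X n) - inverse (Y n))"
proof -
  have X: "padic_Cauchy p (\<lambda>n. inverse (X n))" and Y: "padic_Cauchy p (\<lambda>n. inverse (Y n))"
    using assms padic_Cauchy_inverse by auto
  have 1: "padic_null p (\<lambda>n. inverse (Y n) * (inverse (X n) * X n - 1))"
    by (intro padic_null_mult Y padic_null_mult_inverse assms)
  have 2: "padic_null p (\<lambda>n. inverse (X n) * (inverse (Y n) * Y n - 1))"
    by (intro padic_null_mult X padic_null_mult_inverse assms)
  have 3: "padic_null p (\<lambda>n. (inverse (X n) * inverse (Y n)) * (X n - Y n))"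
    by (intro padic_null_mult padic_Cauchy_mult X Y assms)
  have "padic_null p (\<lambda>n. inverse (Y n) * (inverse (X n) * X n - 1)
      - inverse (X n) * (inverse (Y n) * Y n - 1) - (inverse (X n) * inverse (Y n)) * (X n - Y n))"
    by (intro padic_null_diff 1 2 3)
  also have "(\<lambda>n. inverse (Y n) * (inverse (X n) * X n - 1)
      - inverse (X n) * (inverse (Y n) * Y n - 1) - (inverse (X n) * inverse (Y n)) * (X n - Y n))
    = (\<lambda>n. inverse (X n) - inverse (Y n))"
    by (simp add: algebra_simps)
  finally show ?thesis .
qed

lemma padic_rel_refl: "padic_Cauchy p X \<Longrightarrow> padic_rel p X X"
  by (simp add: padic_rel_def)

lemma part_equivp_padic_rel: "part_equivp (padic_rel p)"
proof (rule part_equivpI)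
  show "\<exists>X. padic_rel p X X" by (rule exI[of _ "\<lambda>_. 0"]) (simp add: padic_rel_refl)
  show "symp (padic_rel p)"
    by (rule sympI) (auto simp: padic_rel_def padic_null_def padic_abs_rat_diff_commute)
  show "transp (padic_rel p)"
  proof (rule transpI)
    fix X Y Z assume "padic_rel p X Y" "padic_rel p Y Z"
    thus "padic_rel p X Z"
      using padic_null_add[of "\<lambda>n. X n - Y n" "\<lambda>n. Y n - Z n"] by (simp add: padic_rel_def)
  qed
qed

lemma padic_rel_abs_lim:
  assumes "padic_rel p X Y"
  shows "lim (\<lambda>n. N (X n)) = lim (\<lambda>n. N (Y n))"
proof -
  obtain L where L: "(\<lambda>n. N (Y n)) \<longlonglongrightarrow> L"
    using padic_Cauchy_convergent[of Y] assms by (auto simp: convergent_def padic_rel_def)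
  have "(\<lambda>n. N (X n) - N (Y n)) \<longlonglongrightarrow> 0"
    by (rule Lim_null_comparison[where g = "\<lambda>n. N (X n - Y n)"])
       (use assms padic_abs_rat_reverse_triangle in \<open>auto simp: padic_rel_def padic_null_def\<close>)
  from tendsto_add[OF this L] have "(\<lambda>n. N (X n)) \<longlonglongrightarrow> L" by simp
  with L show ?thesis by (simp add: limI)
qed

end

section \<open>The field of \<open>p\<close>-adic numbers\<close>

text \<open>
  The prime is carried by the type: \<open>p = CARD('p)\<close> for \<open>'p :: prime_card\<close>. The field is the
  completion of the rationals, i.e. Cauchy sequences modulo null sequences.
\<close>

typedef (overloaded) 'p padic =
    "{Collect (padic_rel CARD('p::prime_card) X) |X. padic_Cauchy CARD('p) X}"
  by (auto intro: exI[of _ "\<lambda>_. 0"])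

definition abs_padic :: "(nat \<Rightarrow> rat) \<Rightarrow> 'p::prime_card padic" where
  "abs_padic X = Abs_padic (Collect (padic_rel CARD('p) X))"

definition rep_padic :: "'p::prime_card padic \<Rightarrow> nat \<Rightarrow> rat" where
  "rep_padic x = (SOME X. X \<in> Rep_padic x)"

definition cr_padic :: "(nat \<Rightarrow> rat) \<Rightarrow> 'p::prime_card padic \<Rightarrow> bool" where
  "cr_padic = (\<lambda>X x. padic_rel CARD('p) X X \<and> abs_padic X = x)"

lemma Quotient_padic:
  "Quotient (padic_rel CARD('p)) abs_padic rep_padic
     (cr_padic :: (nat \<Rightarrow> rat) \<Rightarrow> 'p::prime_card padic \<Rightarrow> bool)"
proof (rule QuotientI)
  let ?R = "padic_rel CARD('p)"
  have R: "part_equivp ?R" by (rule part_equivp_padic_rel[OF prime_card])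
  hence sym: "?R X Y \<Longrightarrow> ?R Y X" and trans: "?R X Y \<Longrightarrow> ?R Y Z \<Longrightarrow> ?R X Z" for X Y Z
    by (auto dest: part_equivp_symp part_equivp_transp)
  have Cauchy: "padic_Cauchy CARD('p) X \<longleftrightarrow> ?R X X" for X
    by (auto simp: padic_rel_def)
  have rep: "?R (rep_padic x) (rep_padic x) \<and> Rep_padic x = Collect (?R (rep_padic x))"
    for x :: "'p padic"
  proof -
    obtain X where X: "Rep_padic x = Collect (?R X)" "?R X X"
      using Rep_padic[of x] Cauchy by auto
    have "X \<in> Rep_padic x" using X by simp
    hence "rep_padic x \<in> Rep_padic x" unfolding rep_padic_def by (rule someI[of "\<lambda>Y. Y \<in> Rep_padic x"])
    hence "?R X (rep_padic x)" using X(1) by simp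
    hence "?R (rep_padic x) (rep_padic x)" "\<And>Y. ?R X Y \<longleftrightarrow> ?R (rep_padic x) Y"
      using sym trans by blast+
    thus ?thesis using X(1) by (simp add: set_eq_iff)
  qed
  show "abs_padic (rep_padic x) = x" for x :: "'p padic"
    unfolding abs_padic_def using rep[of x] by (metis Rep_padic_inverse)
  show "?R (rep_padic x) (rep_padic x)" for x :: "'p padic"
    using rep by blast
  show "?R X Y \<longleftrightarrow> ?R X X \<and> ?R Y Y \<and> abs_padic X = (abs_padic Y :: 'p padic)" for X Y
  proof (cases "?R X X \<and> ?R Y Y")
    case True
    hence "abs_padic X = (abs_padic Y :: 'p padic) \<longleftrightarrow> Collect (?R X) = Collect (?R Y)"
      unfolding abs_padic_def by (intro Abs_padic_inject) (use Cauchy in blast)+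
    also have "\<dots> \<longleftrightarrow> ?R X Y" using True sym trans by (blast intro: set_eqI)
    finally show ?thesis using True by simp
  qed (use sym trans in blast)
qed (rule cr_padic_def)

setup_lifting Quotient_padic

instantiation padic :: (prime_card) field
begin

lift_definition zero_padic :: "'a padic" is "\<lambda>n. 0"
  by (simp add: padic_rel_def)

lift_definition one_padic :: "'a padic" is "\<lambda>n. 1"
  by (simp add: padic_rel_def)

lift_definition plus_padic :: "'a padic \<Rightarrow> 'a padic \<Rightarrow> 'a padic" is "\<lambda>X Y n. X n + Y n"
  unfolding padic_rel_def add_diff_add
  by (auto intro: padic_Cauchy_add padic_null_add prime_card)

lift_definition uminus_padic :: "'a padic \<Rightarrow> 'a padic" is "\<lambda>X n. - X n"
  unfolding padic_rel_def minus_diff_minus padic_null_minus[OF prime_card]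
  by (auto intro: padic_Cauchy_minus prime_card)

lift_definition minus_padic :: "'a padic \<Rightarrow> 'a padic \<Rightarrow> 'a padic" is "\<lambda>X Y n. X n - Y n"
proof -
  fix X Y U V :: "nat \<Rightarrow> rat"
  assume *: "padic_rel CARD('a) X Y" "padic_rel CARD('a) U V"
  hence "padic_null CARD('a) (\<lambda>n. (X n - Y n) - (U n - V n))"
    by (auto simp: padic_rel_def intro: padic_null_diff prime_card)
  also have "(\<lambda>n. (X n - Y n) - (U n - V n)) = (\<lambda>n. X n - U n - (Y n - V n))" by auto
  finally show "padic_rel CARD('a) (\<lambda>n. X n - U n) (\<lambda>n. Y n - V n)"
    using * by (auto simp: padic_rel_def intro: padic_Cauchy_diff prime_card)
qed

lift_definition times_padic :: "'a padic \<Rightarrow> 'a padic \<Rightarrow> 'a padic" is "\<lambda>X Y n. X n * Y n"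
proof -
  fix X Y U V :: "nat \<Rightarrow> rat"
  assume *: "padic_rel CARD('a) X Y" "padic_rel CARD('a) U V"
  hence "padic_null CARD('a) (\<lambda>n. X n * (U n - V n) + V n * (X n - Y n))"
    by (auto simp: padic_rel_def intro!: padic_null_add padic_null_mult prime_card)
  also have "(\<lambda>n. X n * (U n - V n) + V n * (X n - Y n)) = (\<lambda>n. X n * U n - Y n * V n)"
    by (simp add: algebra_simps)
  finally show "padic_rel CARD('a) (\<lambda>n. X n * U n) (\<lambda>n. Y n * V n)"
    using * by (auto simp: padic_rel_def intro: padic_Cauchy_mult prime_card)
qed

lift_definition inverse_padic :: "'a padic \<Rightarrow> 'a padic"
  is "\<lambda>X. if padic_null CARD('a) X then (\<lambda>n. 0) else (\<lambda>n. inverse (X n))"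
proof -
  fix X Y :: "nat \<Rightarrow> rat"
  assume *: "padic_rel CARD('a) X Y"
  have "padic_null CARD('a) X \<longleftrightarrow> padic_null CARD('a) Y"
    using * padic_null_add[OF prime_card, of "\<lambda>n. X n - Y n" Y]
      padic_null_diff[OF prime_card, of X "\<lambda>n. X n - Y n"]
    by (auto simp: padic_rel_def)
  thus "padic_rel CARD('a) (if padic_null CARD('a) X then (\<lambda>n. 0) else (\<lambda>n. inverse (X n)))
      (if padic_null CARD('a) Y then (\<lambda>n. 0) else (\<lambda>n. inverse (Y n)))"
    using * by (auto simp: padic_rel_def
        intro: padic_Cauchy_inverse padic_null_diff_inverse prime_card)
qed

definition divide_padic :: "'a padic \<Rightarrow> 'a padic \<Rightarrow> 'a padic" where
  "divide_padic x y = x * inverse y"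

instance
proof
  fix a b c :: "'a padic"
  note intros = padic_Cauchy_add padic_Cauchy_mult padic_Cauchy_diff padic_Cauchy_minus prime_card
  show "a + b + c = a + (b + c)"
    by transfer (auto simp: padic_rel_def algebra_simps intro!: intros)
  show "a + b = b + a"
    by transfer (auto simp: padic_rel_def algebra_simps intro!: intros)
  show "0 + a = a"
    by transfer (auto simp: padic_rel_def)
  show "- a + a = 0"
    by transfer (auto simp: padic_rel_def)
  show "a - b = a + - b"
    by transfer (auto simp: padic_rel_def intro!: intros)
  show "a * b * c = a * (b * c)"
    by transfer (auto simp: padic_rel_def algebra_simps intro!: intros)
  show "a * b = b * a"
    by transfer (auto simp: padic_rel_def algebra_simps intro!: intros)
  show "1 * a = a"
    by transfer (auto simp: padic_rel_def)
  show "(a + b) * c = a * c + b * c"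
    by transfer (auto simp: padic_rel_def algebra_simps intro!: intros)
  show "(0 :: 'a padic) \<noteq> 1"
    by transfer (simp add: padic_rel_def padic_null_def
        padic_abs_rat_minus[OF prime_card] padic_abs_rat_1[OF prime_card] tendsto_const_iff)
  show "a \<noteq> 0 \<Longrightarrow> inverse a * a = 1"
    by transfer (auto simp: padic_rel_def
        intro!: intros padic_Cauchy_inverse padic_null_mult_inverse)
  show "a div b = a * inverse b"
    by (rule divide_padic_def)
  show "inverse (0 :: 'a padic) = 0"
    by transfer (simp add: padic_rel_def)
qed

end

section \<open>Absolute value and topology\<close>

lift_definition padic_abs :: "'p::prime_card padic \<Rightarrow> real"
  is "\<lambda>X. lim (\<lambda>n. padic_abs_rat CARD('p) (X n))"
  by (rule padic_rel_abs_lim[OF prime_card])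

lemma padic_Cauchy_LIMSEQ:
  assumes "prime p" "padic_Cauchy p X"
  shows "(\<lambda>n. padic_abs_rat p (X n)) \<longlonglongrightarrow> lim (\<lambda>n. padic_abs_rat p (X n))"
  using padic_Cauchy_convergent[OF assms] by (simp add: convergent_LIMSEQ_iff)

lemma padic_abs_nonneg [simp]: "0 \<le> padic_abs x"
  by transfer (auto simp: padic_rel_def padic_abs_rat_nonneg[OF prime_card]
      intro!: LIMSEQ_le_const[OF padic_Cauchy_LIMSEQ[OF prime_card]])

lemma padic_abs_eq_0 [simp]: "padic_abs x = 0 \<longleftrightarrow> x = 0"
proof transfer
  fix X :: "nat \<Rightarrow> rat"
  assume X: "padic_rel CARD('a) X X"
  hence "(\<lambda>n. padic_abs_rat CARD('a) (X n)) \<longlonglongrightarrow> lim (\<lambda>n. padic_abs_rat CARD('a) (X n))"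
    by (intro padic_Cauchy_LIMSEQ prime_card) (simp add: padic_rel_def)
  hence "lim (\<lambda>n. padic_abs_rat CARD('a) (X n)) = 0 \<longleftrightarrow> padic_null CARD('a) X"
    unfolding padic_null_def by (metis limI)
  thus "lim (\<lambda>n. padic_abs_rat CARD('a) (X n)) = 0 \<longleftrightarrow> padic_rel CARD('a) X (\<lambda>n. 0)"
    using X by (simp add: padic_rel_def)
qed

lemma padic_abs_mult: "padic_abs (x * y) = padic_abs x * padic_abs y"
  by transfer (auto simp: padic_rel_def padic_abs_rat_mult[OF prime_card]
      intro!: limI tendsto_mult padic_Cauchy_LIMSEQ[OF prime_card])

lemma padic_abs_minus [simp]: "padic_abs (- x) = padic_abs x"
  by transfer (simp add: padic_abs_rat_minus[OF prime_card])

lemma padic_abs_ultrametric: "padic_abs (x + y) \<le> max (padic_abs x) (padic_abs y)"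
proof transfer
  fix X Y :: "nat \<Rightarrow> rat"
  let ?N = "padic_abs_rat CARD('a)"
  assume "padic_rel CARD('a) X X" "padic_rel CARD('a) Y Y"
  hence X: "padic_Cauchy CARD('a) X" and Y: "padic_Cauchy CARD('a) Y"
    by (auto simp: padic_rel_def)
  note lims = padic_Cauchy_LIMSEQ[OF prime_card]
  show "lim (\<lambda>n. ?N (X n + Y n)) \<le> max (lim (\<lambda>n. ?N (X n))) (lim (\<lambda>n. ?N (Y n)))"
    by (rule LIMSEQ_le[OF lims tendsto_max[OF lims lims]])
       (auto intro: X Y padic_Cauchy_add prime_card padic_abs_rat_add)
qed

instantiation padic :: (prime_card) metric_space
begin

definition dist_padic :: "'a padic \<Rightarrow> 'a padic \<Rightarrow> real" where
  "dist_padic x y = padic_abs (x - y)"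

definition uniformity_padic :: "('a padic \<times> 'a padic) filter" where
  "uniformity_padic = (INF e\<in>{0<..}. principal {(x, y). dist x y < e})"

definition open_padic :: "'a padic set \<Rightarrow> bool" where
  "open_padic U \<longleftrightarrow> (\<forall>x\<in>U. \<forall>\<^sub>F (x', y) in uniformity. x' = x \<longrightarrow> y \<in> U)"

instance
proof
  fix x y z :: "'a padic"
  show "dist x y = 0 \<longleftrightarrow> x = y" by (simp add: dist_padic_def)
  have "padic_abs (x - y) \<le> max (padic_abs (x - z)) (padic_abs (z - y))"
    using padic_abs_ultrametric[of "x - z" "z - y"] by simp
  also have "padic_abs (z - y) = padic_abs (y - z)"
    using padic_abs_minus[of "z - y"] by simp
  finally show "dist x y \<le> dist x z + dist y z"
    using padic_abs_nonneg[of "x - z"] padic_abs_nonneg[of "y - z"]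
    unfolding dist_padic_def by linarith
qed (rule uniformity_padic_def open_padic_def)+

end

lemma padic_of_nat_transfer: "(of_nat n :: 'p::prime_card padic) = abs_padic (\<lambda>_. of_nat n)"
proof (induction n)
  case 0
  show ?case by (simp add: zero_padic_def)
next
  case (Suc n)
  thus ?case
    by (simp add: one_padic_def plus_padic.abs_eq padic_rel_refl[OF prime_card])
qed

lemma padic_abs_of_nat:
  "padic_abs (of_nat n :: 'p::prime_card padic) = padic_abs_rat CARD('p) (of_nat n)"
  unfolding padic_of_nat_transfer
  by (simp add: padic_abs.abs_eq padic_rel_refl[OF prime_card] limI)

instance padic :: (prime_card) field_char_0
proof
  show "inj (of_nat :: nat \<Rightarrow> 'a padic)"
  proof (rule linorder_injI)
    fix m n :: nat
    assume "m < n"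
    hence "padic_abs (of_nat (n - m) :: 'a padic) \<noteq> 0"
      unfolding padic_abs_of_nat by (simp add: padic_abs_rat_eq_0[OF prime_card])
    thus "(of_nat m :: 'a padic) \<noteq> of_nat n"
      using \<open>m < n\<close> by (auto simp: of_nat_diff)
  qed
qed

lemma padic_abs_of_rat:
  "padic_abs (of_rat x :: 'p::prime_card padic) = padic_abs_rat CARD('p) x"
proof -
  have of_int: "padic_abs (of_int a :: 'p padic) = padic_abs_rat CARD('p) (of_int a)" for a
    by (cases a rule: int_cases2)
       (simp_all add: padic_abs_of_nat padic_abs_rat_minus[OF prime_card])
  obtain a b where x: "x = Rat.Fract a b" "b > 0" by (cases x) auto
  hence eq: "x * of_int b = of_int a"
    by (simp add: Fract_of_int_quotient)
  hence "(of_rat x :: 'p padic) * of_int b = of_int a"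
    by (metis of_rat_mult of_rat_of_int_eq)
  hence "padic_abs (of_rat x :: 'p padic) * padic_abs_rat CARD('p) (of_int b)
      = padic_abs_rat CARD('p) (of_int a)"
    by (metis padic_abs_mult of_int)
  also have "\<dots> = padic_abs_rat CARD('p) x * padic_abs_rat CARD('p) (of_int b)"
    by (simp flip: eq add: padic_abs_rat_mult[OF prime_card])
  finally show ?thesis
    using x padic_abs_rat_eq_0[OF prime_card[where ?'a = 'p], of "of_int b"] by simp
qed

definition padic_ball :: "'p::prime_card padic \<Rightarrow> int \<Rightarrow> 'p padic set" where
  "padic_ball a l = {x. padic_abs (x - a) \<le> real CARD('p) powi l}"

section \<open>Haar measure\<close>

text \<open>
  Translation-invariant Borel measure giving the closed unit ball measure one. Regularity and
  local finiteness need not be required: the balls of radius one cover the space, which is a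
  separable metric space.
\<close>

definition normalized_Haar :: "'p::prime_card padic measure \<Rightarrow> bool" where
  "normalized_Haar \<mu> \<longleftrightarrow>
     sets \<mu> = sets borel \<and>
     (\<forall>a. \<forall>E\<in>sets borel. emeasure \<mu> ((\<lambda>x. a + x) ` E) = emeasure \<mu> E) \<and>
     emeasure \<mu> {x. padic_abs x \<le> 1} = 1"

definition locally_integrable ::
    "'a::topological_space measure \<Rightarrow> ('a \<Rightarrow> 'b::{banach, second_countable_topology}) \<Rightarrow> bool" where
  "locally_integrable \<mu> f \<longleftrightarrow> (\<forall>K. compact K \<longrightarrow> set_integrable \<mu> K f)"

section \<open>Fractional Cesaro--Morrey spaces\<close>

text \<open>Powers of extended non-negative reals, for exponents \<open>s > 0\<close>.\<close>

definition ennreal_powr :: "ennreal \<Rightarrow> real \<Rightarrow> ennreal" where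
  "ennreal_powr x s = (if x = \<infinity> then \<infinity> else ennreal (enn2real x powr s))"

text \<open>At \<open>x = 0\<close>, a point of measure zero, the factor \<open>1 / \<bar>x\<bar>\<close> below takes the value \<open>0\<close>.\<close>

definition Cesaro_mean ::
    "'p::prime_card padic measure \<Rightarrow> real \<Rightarrow> ('p padic \<Rightarrow> complex) \<Rightarrow> 'p padic \<Rightarrow> ennreal" where
  "Cesaro_mean \<mu> \<beta> f x =
     ennreal (1 / padic_abs x powr (1 - \<beta>)) *
     (\<integral>\<^sup>+t\<in>{t. padic_abs t \<le> padic_abs x}. ennreal (norm (f t)) \<partial>\<mu>)"

definition Cesaro_Morrey_norm ::
    "'p::prime_card padic measure \<Rightarrow> real \<Rightarrow> real \<Rightarrow> real \<Rightarrow> ('p padic \<Rightarrow> complex) \<Rightarrow> ennreal" where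
  "Cesaro_Morrey_norm \<mu> \<beta> r q f =
     (SUP (a, l)\<in>UNIV.
        ennreal (measure \<mu> (padic_ball a l) powr (1 / q - 1 / r)) *
        ennreal_powr (\<integral>\<^sup>+x\<in>padic_ball a l. ennreal_powr (Cesaro_mean \<mu> \<beta> f x) r \<partial>\<mu>) (1 / r))"

definition Cesaro_Morrey_space ::
    "'p::prime_card padic measure \<Rightarrow> real \<Rightarrow> real \<Rightarrow> real \<Rightarrow> ('p padic \<Rightarrow> complex) set" where
  "Cesaro_Morrey_space \<mu> \<beta> r q =
     {f. locally_integrable \<mu> f \<and> Cesaro_Morrey_norm \<mu> \<beta> r q f < \<infinity>}"

section \<open>The Hardy operator\<close>

definition padic_Hardy ::
    "'p::prime_card padic measure \<Rightarrow> ('p padic \<Rightarrow> complex) \<Rightarrow> 'p padic \<Rightarrow> complex" where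
  "padic_Hardy \<mu> f x =
     (1 / padic_abs x) *\<^sub>R (LINT y:{y. padic_abs y \<le> padic_abs x}|\<mu>. f y)"

definition Hardy_kernel :: "real \<Rightarrow> real \<Rightarrow> real" where
  "Hardy_kernel s t = (if 0 < t \<and> t \<le> s then inverse s else 0)"

definition Hardy_const :: "nat \<Rightarrow> real \<Rightarrow> real \<Rightarrow> real" where
  "Hardy_const p \<beta> q =
     (1 - inverse (real p)) *
     (\<Sum>\<^sub>\<infinity>j\<in>(UNIV :: int set).
        Hardy_kernel 1 (real p powi j) * real p powr (of_int j * (1 - \<beta> - 1 / q)))"

end

theory Submission
  imports Defs
begin

text \<open>
  Everything reduces to radial functions, i.e. functions of \<open>\<bar>x\<bar>\<close>. The Cesaro mean
  \<open>F x = \<bar>x\<bar> powr (\<beta> - 1) * (\<integral>\<bar>t\<bar> \<le> \<bar>x\<bar>. \<bar>f t\<bar>)\<close> is radial, and the Hardy operator is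
  pointwise bounded by the Cesaro mean with \<open>\<beta> = 0\<close>. The absolute value only takes the values
  \<open>p powi k\<close>, and the sphere of radius \<open>p powi k\<close> has measure \<open>(1 - 1/p) * p powi k\<close>. So integrating
  this bound over the ball of radius \<open>\<bar>x\<bar>\<close>, sphere by sphere, gives
  \<open>Cesaro_mean \<mu> \<beta> (padic_Hardy \<mu> f) x \<le> (\<Sum>n. (1 - 1/p) * p powr (- n * (1 - \<beta>)) * F (p ^ n * x))\<close>.

  The terms on the right are dilates of the single function \<open>F\<close>. Dilating by \<open>p ^ n\<close> maps the ball of
  radius \<open>p powi l\<close> around \<open>a\<close> to the one of radius \<open>p powi (l - n)\<close> around \<open>p ^ n * a\<close>, and scales
  integrals by \<open>p ^ n\<close> (\<open>nn_integral_radial_dilate\<close>). With the weight \<open>p powr (l * (1/q - 1/r))\<close>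
  of the Morrey norm, dilation by \<open>p ^ n\<close> therefore costs exactly the factor \<open>p powr (n / q)\<close>.
  Minkowski's inequality for countable sums (\<open>nn_integral_powr_suminf_le\<close>) adds up the pieces, with
  total factor \<open>\<Sum>n. (1 - 1/p) * p powr (- n * (1 - \<beta> - 1/q))\<close>. The kernel vanishes for \<open>j > 0\<close>, so this is
  \<open>Hardy_const\<close> with \<open>j = - n\<close>, and \<open>\<beta> < 1 - 1/q\<close> makes the geometric series converge.

  Two facts about the Haar measure carry this: the ball of radius \<open>p powi l\<close> is the disjoint union of
  \<open>p\<close> translates of the next smaller one, so its measure is \<open>p powi l\<close> (\<open>emeasure_padic_ball\<close>), and a
  ball either contains \<open>0\<close> or lies in a single sphere, so that integrals of radial functions over
  balls are explicit.
\<close>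

section \<open>The value group and the residue field\<close>

lemma real_card_gt_1: "1 < real CARD('p::prime_card)"
  using prime_gt_1_nat[OF prime_card[where ?'a='p]] by simp

text \<open>
  Constant sequences represent the rationals. This lets distances to rationals be computed on
  representing Cauchy sequences.
\<close>

lemma padic_of_rat_transfer: "(of_rat u :: 'p::prime_card padic) = abs_padic (\<lambda>_. u)"
proof -
  have C: "padic_rel CARD('p) (\<lambda>_. c) (\<lambda>_. c)" for c
    by (rule padic_rel_refl[OF prime_card]) simp
  have of_int: "(of_int a :: 'p padic) = abs_padic (\<lambda>_. of_int a)" for a
    by (cases a rule: int_cases2)
       (simp_all add: padic_of_nat_transfer uminus_padic.abs_eq[OF C])
  obtain a b where u: "u = Rat.Fract a b" "b > 0" by (cases u) auto
  hence eq: "u * of_int b = of_int a"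
    by (simp add: Fract_of_int_quotient)
  hence 1: "(of_rat u :: 'p padic) * of_int b = of_int a"
    by (metis of_rat_mult of_rat_of_int_eq)
  have 2: "(abs_padic (\<lambda>_. u) :: 'p padic) * of_int b = of_int a"
    by (simp add: of_int times_padic.abs_eq[OF C C] eq)
  have "(of_int b :: 'p padic) \<noteq> 0" using u by simp
  thus ?thesis using 1 2 by (metis mult_right_cancel)
qed

text \<open>
  The rationals are dense: a late enough member of a representing Cauchy sequence is as close as
  desired.
\<close>

lemma padic_approx_rat:
  fixes x :: "'p::prime_card padic"
  assumes e: "e > 0"
  obtains u where "padic_abs (x - of_rat u) < e"
proof -
  let ?N = "padic_abs_rat CARD('p)"
  define X where "X = rep_padic x"
  have x: "x = abs_padic X"
    unfolding X_def by (rule Quotient_abs_rep[OF Quotient_padic, symmetric])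
  have rX: "padic_rel CARD('p) X X"
    unfolding X_def by (rule Quotient_rep_reflp[OF Quotient_padic])
  hence CX: "padic_Cauchy CARD('p) X" by (simp add: padic_rel_def)
  obtain k where k: "\<And>m n. m \<ge> k \<Longrightarrow> n \<ge> k \<Longrightarrow> ?N (X m - X n) < e / 2"
    using padic_CauchyD[OF prime_card CX, of "e / 2"] e by auto
  have rc: "padic_rel CARD('p) (\<lambda>_. X k) (\<lambda>_. X k)"
    by (rule padic_rel_refl[OF prime_card]) simp
  have CD: "padic_Cauchy CARD('p) (\<lambda>n. X n - X k)"
    by (intro padic_Cauchy_diff prime_card CX) simp
  have "padic_abs (x - of_rat (X k)) = lim (\<lambda>n. ?N (X n - X k))"
    unfolding x padic_of_rat_transfer minus_padic.abs_eq[OF rX rc]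
    by (rule padic_abs.abs_eq) (rule padic_rel_refl[OF prime_card CD])
  also have "\<dots> \<le> e / 2"
    by (rule LIMSEQ_le_const2[OF padic_Cauchy_LIMSEQ[OF prime_card CD]])
       (use k less_imp_le in blast)
  also have "\<dots> < e" using e by simp
  finally show ?thesis by (rule that)
qed

lemma padic_abs_0 [simp]: "padic_abs 0 = 0"
  by (simp only: padic_abs_eq_0)

lemma padic_abs_diff_commute: "padic_abs (x - y) = padic_abs (y - x)"
  by (metis minus_diff_eq padic_abs_minus)

lemma padic_abs_eq_of_close:
  assumes "padic_abs (x - y) < padic_abs x"
  shows "padic_abs y = padic_abs x"
proof -
  have "padic_abs x \<le> max (padic_abs (x - y)) (padic_abs y)"
    using padic_abs_ultrametric[of "x - y" y] by simp
  moreover have "padic_abs y \<le> max (padic_abs (y - x)) (padic_abs x)"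
    using padic_abs_ultrametric[of "y - x" x] by simp
  ultimately show ?thesis using assms padic_abs_diff_commute[of x y] by auto
qed

text \<open>
  By the ultrametric inequality, a rational closer to \<open>x\<close> than \<open>\<bar>x\<bar>\<close> has the same absolute value,
  so completing the rationals creates no new absolute values.
\<close>

lemma padic_abs_values:
  fixes x :: "'p::prime_card padic"
  assumes "x \<noteq> 0"
  obtains k where "padic_abs x = real CARD('p) powi k"
proof -
  have pos: "padic_abs x > 0" using assms padic_abs_nonneg[of x] by (simp add: order_less_le)
  obtain u where "padic_abs (x - of_rat u) < padic_abs x"
    using padic_approx_rat[OF pos] .
  hence eq: "padic_abs x = padic_abs_rat CARD('p) u"
    using padic_abs_eq_of_close padic_abs_of_rat by metis
  hence "u \<noteq> 0" using pos by auto
  thus ?thesis using that eq unfolding padic_abs_rat_def by auto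
qed

lemma padic_abs_of_int:
  "padic_abs (of_int a :: 'p::prime_card padic)
     = (if a = 0 then 0 else real CARD('p) powi (- int (multiplicity (int CARD('p)) a)))"
proof -
  have "padic_abs (of_int a :: 'p padic) = padic_abs_rat CARD('p) (of_int a)"
    using padic_abs_of_rat[of "of_int a", where ?'p='p] by simp
  thus ?thesis by (simp add: padic_abs_rat_def)
qed

lemma padic_abs_of_int_le_1: "padic_abs (of_int a :: 'p::prime_card padic) \<le> 1"
  using real_card_gt_1[where ?'p='p]
  by (simp add: padic_abs_of_int power_int_minus inverse_le_1_iff)

lemma padic_abs_1 [simp]: "padic_abs 1 = 1"
  using padic_abs_of_int[of 1] by simp

lemma padic_abs_inverse: "padic_abs (inverse x) = inverse (padic_abs x)"
proof (cases "x = 0")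
  case False
  hence "padic_abs x * padic_abs (inverse x) = 1" by (simp flip: padic_abs_mult)
  thus ?thesis by (metis inverse_unique)
qed auto

lemma padic_abs_power: "padic_abs (x ^ n) = padic_abs x ^ n"
  by (induction n) (simp_all add: padic_abs_mult)

lemma padic_abs_power_int: "padic_abs (x powi k) = padic_abs x powi k"
  by (cases k rule: int_cases2) (simp_all add: padic_abs_power padic_abs_inverse power_int_minus)

lemma padic_abs_prime: "padic_abs (of_nat CARD('p) :: 'p::prime_card padic) = inverse (real CARD('p))"
proof -
  have "prime (int CARD('p))" using prime_card[where ?'a='p] by simp
  hence "multiplicity (int CARD('p)) (int CARD('p)) = 1"
    using prime_card[where ?'a='p] by (intro multiplicity_prime) auto
  thus ?thesis using padic_abs_of_int[of "int CARD('p)", where ?'p='p]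
    by (simp add: power_int_minus)
qed

lemma padic_abs_prime_powi:
  "padic_abs (of_nat CARD('p) powi k :: 'p::prime_card padic) = real CARD('p) powi (- k)"
  by (simp add: padic_abs_power_int padic_abs_prime power_int_minus power_int_inverse)

lemma padic_abs_less_1_imp:
  fixes x :: "'p::prime_card padic"
  assumes "padic_abs x < 1"
  shows "padic_abs x \<le> inverse (real CARD('p))"
proof (cases "x = 0")
  case False
  then obtain k where k: "padic_abs x = real CARD('p) powi k" by (rule padic_abs_values)
  note p = real_card_gt_1[where ?'p='p]
  have "k < 0"
  proof (rule ccontr)
    assume "\<not> k < 0"
    hence "real CARD('p) powi 0 \<le> real CARD('p) powi k"
      using p by (intro power_int_increasing) auto
    thus False using k assms by simp
  qed
  hence "real CARD('p) powi k \<le> real CARD('p) powi (-1)"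
    using p by (intro power_int_increasing) auto
  thus ?thesis using k by (simp add: power_int_minus)
qed simp

text \<open>
  The residue field has only the \<open>p\<close> elements of the prime field. Approximate \<open>x\<close> by a rational \<open>a / b\<close>
  in lowest terms. As \<open>\<bar>a / b\<bar> \<le> 1\<close>, the prime does not divide \<open>b\<close>, and the residue is \<open>a\<close> times the
  inverse of \<open>b\<close> modulo \<open>p\<close>.
\<close>

lemma padic_residue:
  fixes x :: "'p::prime_card padic"
  assumes "padic_abs x \<le> 1"
  obtains i where "i < CARD('p)" "padic_abs (x - of_nat i) < 1"
proof -
  let ?p = "int CARD('p)"
  have P: "prime ?p" using prime_card[where ?'a='p] by simp
  note p1 = real_card_gt_1[where ?'p='p]
  obtain u where u: "padic_abs (x - of_rat u) < 1"
    using padic_approx_rat[of 1] by auto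
  have "padic_abs (of_rat u :: 'p padic) \<le> max (padic_abs (of_rat u - x)) (padic_abs x)"
    using padic_abs_ultrametric[of "of_rat u - x" x] by simp
  hence u1: "padic_abs (of_rat u :: 'p padic) \<le> 1"
    using u assms padic_abs_diff_commute[of x "of_rat u"] by simp
  obtain a b where ab: "quotient_of u = (a, b)" by force
  have b: "b > 0" using ab by (rule quotient_of_denom_pos)
  have cop: "coprime a b" using ab by (rule quotient_of_coprime)
  have "u = of_int a / of_int b" using ab by (rule quotient_of_div)
  hence "(of_rat u :: 'p padic) = of_int a / of_int b" by (simp add: of_rat_divide)
  hence ub: "(of_rat u :: 'p padic) * of_int b = of_int a" using b by simp
  \<comment> \<open>Otherwise \<open>\<bar>a\<bar> = 1\<close> and \<open>\<bar>b\<bar> < 1\<close>, so \<open>\<bar>a / b\<bar> > 1\<close>.\<close>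
  have pb: "\<not> ?p dvd b"
  proof
    assume d: "?p dvd b"
    hence "\<not> ?p dvd a" using cop P by (meson coprime_common_divisor not_prime_unit)
    hence a1: "padic_abs (of_int a :: 'p padic) = 1"
      using padic_abs_of_int[of a, where ?'p='p] by (auto simp: not_dvd_imp_multiplicity_0)
    from d obtain c where c: "b = ?p * c" by blast
    have "padic_abs (of_int b :: 'p padic) = inverse (real CARD('p)) * padic_abs (of_int c :: 'p padic)"
      by (simp add: c padic_abs_mult padic_abs_prime)
    also have "\<dots> \<le> inverse (real CARD('p)) * 1"
      using p1 by (intro mult_left_mono padic_abs_of_int_le_1) auto
    also have "\<dots> < 1" using p1 by (simp add: inverse_less_1_iff)
    finally have "padic_abs (of_int b :: 'p padic) < 1" .
    moreover note a1 moreover have "padic_abs (of_int a :: 'p padic)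
        = padic_abs (of_rat u :: 'p padic) * padic_abs (of_int b :: 'p padic)"
      by (simp flip: ub padic_abs_mult)
    ultimately show False using u1 mult_mono[OF u1, of "padic_abs (of_int b :: 'p padic)" "padic_abs (of_int b :: 'p padic)"]
      by simp
  qed
  hence "coprime b ?p" using P by (metis coprime_commute prime_imp_coprime)
  then obtain b' where b': "[b * b' = 1] (mod ?p)" using cong_solve_coprime_int by blast
  define i where "i = nat ((a * b') mod ?p)"
  have i: "int i = (a * b') mod ?p" unfolding i_def using P by (simp add: prime_gt_0_int)
  have "[int i = a * b'] (mod ?p)" by (simp add: i cong_def)
  hence "[int i * b = a * b' * b] (mod ?p)" by (intro cong_mult cong_refl)
  hence "[int i * b = a * (b * b')] (mod ?p)" by (simp add: algebra_simps)
  also have "[a * (b * b') = a * 1] (mod ?p)" by (intro cong_mult cong_refl b')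
  finally have "?p dvd a - int i * b"
    by (metis cong_iff_dvd_diff cong_sym mult.right_neutral)
  then obtain c where c: "a - int i * b = ?p * c" by blast
  have "(of_rat u - of_nat i) * of_int b = (of_int (a - int i * b) :: 'p padic)"
    by (simp add: left_diff_distrib ub)
  also have "\<dots> = of_nat CARD('p) * of_int c" by (simp add: c)
  finally have "padic_abs ((of_rat u - of_nat i :: 'p padic)) * padic_abs (of_int b :: 'p padic)
      = inverse (real CARD('p)) * padic_abs (of_int c :: 'p padic)"
    by (metis padic_abs_mult padic_abs_prime)
  moreover have "padic_abs (of_int b :: 'p padic) = 1"
    using padic_abs_of_int[of b, where ?'p='p] pb b by (simp add: not_dvd_imp_multiplicity_0)
  ultimately have "padic_abs (of_rat u - of_nat i :: 'p padic)
      = inverse (real CARD('p)) * padic_abs (of_int c :: 'p padic)" by simp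
  also have "\<dots> \<le> inverse (real CARD('p)) * 1"
    using p1 by (intro mult_left_mono padic_abs_of_int_le_1) auto
  also have "\<dots> < 1" using p1 by (simp add: inverse_less_1_iff)
  finally have "padic_abs (of_rat u - of_nat i :: 'p padic) < 1" .
  hence "padic_abs (x - of_nat i) < 1"
    using u padic_abs_ultrametric[of "x - of_rat u" "of_rat u - of_nat i"] by simp
  moreover have "i < CARD('p)"
    using i P by (metis of_nat_less_iff pos_mod_bound prime_gt_0_int)
  ultimately show ?thesis using that by blast
qed

section \<open>Balls, spheres and their Haar measure\<close>

lemma padic_ball_eq_cball: "padic_ball a l = cball a (real CARD('p) powi l)"
  for a :: "'p::prime_card padic"
  by (auto simp: padic_ball_def dist_padic_def padic_abs_diff_commute)

lemma padic_ball_borel [measurable]: "padic_ball a l \<in> sets borel"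
  unfolding padic_ball_eq_cball by simp

lemma continuous_on_padic_abs: "continuous_on UNIV (padic_abs :: 'p::prime_card padic \<Rightarrow> real)"
proof -
  have "continuous_on UNIV (\<lambda>x :: 'p padic. dist x 0)"
    by (intro continuous_on_dist continuous_on_id continuous_on_const)
  thus ?thesis by (simp add: dist_padic_def)
qed

lemma borel_measurable_padic_abs [measurable]: "padic_abs \<in> borel_measurable borel"
  by (intro borel_measurable_continuous_onI continuous_on_padic_abs)

lemma padic_ball_translate: "padic_ball (a + b) l = (\<lambda>x. a + x) ` padic_ball b l"
proof -
  have "x \<in> (\<lambda>x. a + x) ` padic_ball b l" if "x \<in> padic_ball (a + b) l" for x
    using that by (intro image_eqI[of _ _ "x - a"]) (auto simp: padic_ball_def algebra_simps)
  thus ?thesis by (auto simp: padic_ball_def)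
qed

text \<open>
  Discreteness of the value group: open balls are closed balls of the next smaller radius.
\<close>

lemma padic_abs_power_int_less_iff:
  fixes x :: "'p::prime_card padic"
  shows "padic_abs x < real CARD('p) powi l \<longleftrightarrow> padic_abs x \<le> real CARD('p) powi (l - 1)"
proof
  note p1 = real_card_gt_1[where ?'p='p]
  define y where "y = x * of_nat CARD('p) powi l"
  have p0: "real CARD('p) \<noteq> 0" using p1 by simp
  have y: "padic_abs x = padic_abs y * real CARD('p) powi l"
    using p0 by (simp add: y_def padic_abs_mult padic_abs_prime_powi power_int_minus)
  have pos: "real CARD('p) powi l > 0" using p1 by simp
  {
    assume "padic_abs x < real CARD('p) powi l"
    hence "padic_abs y < 1" using pos unfolding y by simp
    hence "padic_abs y \<le> inverse (real CARD('p))" by (rule padic_abs_less_1_imp)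
    hence "padic_abs x \<le> inverse (real CARD('p)) * real CARD('p) powi l"
      unfolding y using pos by (intro mult_right_mono) auto
    thus "padic_abs x \<le> real CARD('p) powi (l - 1)"
      using p0 by (simp add: power_int_diff divide_simps)
  }
  assume "padic_abs x \<le> real CARD('p) powi (l - 1)"
  also have "\<dots> < real CARD('p) powi l" using p1 by (intro power_int_strict_increasing) auto
  finally show "padic_abs x < real CARD('p) powi l" .
qed

text \<open>
  After scaling to the unit ball, the \<open>p\<close> smaller balls are the residue classes.
\<close>

lemma padic_ball_eq_Union:
  "padic_ball (0 :: 'p::prime_card padic) l
     = (\<Union>i<CARD('p). padic_ball (of_nat i * of_nat CARD('p) powi (- l)) (l - 1))"
proof (intro equalityI subsetI)
  fix x :: "'p padic"
  note p1 = real_card_gt_1[where ?'p='p]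
  have p0: "(of_nat CARD('p) :: 'p padic) \<noteq> 0" by simp
  let ?w = "of_nat CARD('p) powi (- l) :: 'p padic"
  have pos: "real CARD('p) powi l > 0" using p1 by simp
  have w: "padic_abs ?w = real CARD('p) powi l" by (simp add: padic_abs_prime_powi)
  {
    assume x: "x \<in> padic_ball 0 l"
    define y where "y = x * of_nat CARD('p) powi l"
    have xy: "x = y * ?w" using p0 by (simp add: y_def power_int_minus)
    have "padic_abs x = padic_abs y * real CARD('p) powi l"
      unfolding xy padic_abs_mult w ..
    hence "padic_abs y \<le> 1" using x pos by (simp add: padic_ball_def)
    then obtain i where i: "i < CARD('p)" "padic_abs (y - of_nat i) < 1" by (rule padic_residue)
    have "padic_abs (x - of_nat i * ?w) = padic_abs (y - of_nat i) * real CARD('p) powi l"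
      unfolding xy by (simp flip: left_diff_distrib add: padic_abs_mult w)
    also have "\<dots> < real CARD('p) powi l" using i pos by simp
    finally show "x \<in> (\<Union>i<CARD('p). padic_ball (of_nat i * ?w) (l - 1))"
      using i by (auto simp: padic_ball_def padic_abs_power_int_less_iff)
  next
    assume "x \<in> (\<Union>i<CARD('p). padic_ball (of_nat i * ?w) (l - 1))"
    then obtain i :: nat where "padic_abs (x - of_nat i * ?w) \<le> real CARD('p) powi (l - 1)"
      by (auto simp: padic_ball_def)
    hence "padic_abs (x - of_nat i * ?w) \<le> real CARD('p) powi l"
      using padic_abs_power_int_less_iff less_imp_le by blast
    moreover have "padic_abs (of_nat i :: 'p padic) \<le> 1"
      using padic_abs_of_int_le_1[of "int i", where ?'p='p] by simp
    hence "padic_abs (of_nat i * ?w) \<le> real CARD('p) powi l"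
      using pos by (simp add: padic_abs_mult w)
    ultimately show "x \<in> padic_ball 0 l"
      using padic_abs_ultrametric[of "x - of_nat i * ?w" "of_nat i * ?w"]
      by (simp add: padic_ball_def)
  }
qed

lemma padic_ball_cosets_disjoint:
  "disjoint_family_on
     (\<lambda>i. padic_ball (of_nat i * of_nat CARD('p) powi (- l) :: 'p::prime_card padic) (l - 1))
     {..<CARD('p)}"
  unfolding disjoint_family_on_def
proof (intro ballI impI equals0I)
  fix i j x
  assume ij: "i \<in> {..<CARD('p)}" "j \<in> {..<CARD('p)}" "i \<noteq> j"
  let ?w = "of_nat CARD('p) powi (- l) :: 'p padic"
  assume "x \<in> padic_ball (of_nat i * ?w) (l - 1) \<inter> padic_ball (of_nat j * ?w) (l - 1)"
  hence "padic_abs (x - of_nat i * ?w) < real CARD('p) powi l"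
        "padic_abs (x - of_nat j * ?w) < real CARD('p) powi l"
    by (auto simp: padic_ball_def padic_abs_power_int_less_iff)
  hence "padic_abs (of_nat j * ?w - of_nat i * ?w) < real CARD('p) powi l"
    using padic_abs_ultrametric[of "of_nat j * ?w - x" "x - of_nat i * ?w"]
    by (simp add: padic_abs_diff_commute)
  also have "of_nat j * ?w - of_nat i * ?w = of_int (int j - int i) * ?w"
    by (simp add: left_diff_distrib)
  finally have "padic_abs (of_int (int j - int i) :: 'p padic) < 1"
    using real_card_gt_1[where ?'p='p] by (simp add: padic_abs_mult padic_abs_prime_powi)
  hence "multiplicity (int CARD('p)) (int j - int i) \<noteq> 0"
    using ij padic_abs_of_int[of "int j - int i", where ?'p='p] by (intro notI) simp
  hence "int CARD('p) dvd int j - int i"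
    by (metis not_dvd_imp_multiplicity_0)
  hence "int CARD('p) \<le> \<bar>int j - int i\<bar>"
    using ij dvd_imp_le_int[of "int j - int i" "int CARD('p)"] by simp
  thus False using ij by auto
qed

context
  fixes \<mu> :: "'p::prime_card padic measure"
  assumes Haar: "normalized_Haar \<mu>"
begin

lemma sets_Haar [measurable_cong]: "sets \<mu> = sets borel"
  using Haar by (simp add: normalized_Haar_def)

lemma space_Haar: "space \<mu> = UNIV"
  using sets_eq_imp_space_eq[OF sets_Haar] by simp

lemma emeasure_padic_ball_center:
  "emeasure \<mu> (padic_ball a l) = emeasure \<mu> (padic_ball 0 l)"
  using Haar padic_ball_translate[of a 0 l] padic_ball_borel[of 0 l]
  by (simp add: normalized_Haar_def)

text \<open>
  The \<open>p\<close> cosets are translates of one ball. This recursion determines the measure of every ball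
  from that of the unit ball.
\<close>

lemma emeasure_padic_ball_step:
  "emeasure \<mu> (padic_ball 0 l) = ennreal (real CARD('p)) * emeasure \<mu> (padic_ball 0 (l - 1))"
proof -
  have "emeasure \<mu> (padic_ball 0 l)
    = (\<Sum>i<CARD('p). emeasure \<mu> (padic_ball (of_nat i * of_nat CARD('p) powi (- l)) (l - 1)))"
    unfolding padic_ball_eq_Union[of l]
    by (intro sum_emeasure[symmetric] padic_ball_cosets_disjoint) (auto simp: sets_Haar)
  also have "\<dots> = ennreal (real CARD('p)) * emeasure \<mu> (padic_ball 0 (l - 1))"
    by (subst emeasure_padic_ball_center) (simp add: ennreal_of_nat_eq_real_of_nat)
  finally show ?thesis .
qed

lemma emeasure_padic_ball: "emeasure \<mu> (padic_ball a l) = ennreal (real CARD('p) powi l)"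
proof -
  note p1 = real_card_gt_1[where ?'p='p]
  have "emeasure \<mu> (padic_ball 0 l) = ennreal (real CARD('p) powi l)"
  proof (induction l rule: int_induct[where k = 0])
    case base
    show ?case using Haar by (simp add: normalized_Haar_def padic_ball_def)
  next
    case (step1 i)
    have "real CARD('p) powi (i + 1) = real CARD('p) * real CARD('p) powi i"
      using p1 by (simp add: power_int_add)
    thus ?case using p1 emeasure_padic_ball_step[of "i + 1"] step1
      by (simp add: ennreal_mult)
  next
    case (step2 i)
    have "real CARD('p) powi i = real CARD('p) * real CARD('p) powi (i - 1)"
      using p1 by (simp add: power_int_diff)
    hence "ennreal (real CARD('p)) * emeasure \<mu> (padic_ball 0 (i - 1))
        = ennreal (real CARD('p)) * ennreal (real CARD('p) powi (i - 1))"
      using p1 emeasure_padic_ball_step[of "i"] step2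
      by (simp add: ennreal_mult)
    thus ?case using p1 by (simp add: ennreal_mult_cancel_left)
  qed
  thus ?thesis by (simp only: emeasure_padic_ball_center[of a l])
qed

lemma measure_padic_ball: "measure \<mu> (padic_ball a l) = real CARD('p) powi l"
  using real_card_gt_1[where ?'p='p] by (simp add: measure_def emeasure_padic_ball)

lemma emeasure_padic_sphere:
  "emeasure \<mu> {x. padic_abs x = real CARD('p) powi k}
     = ennreal ((1 - inverse (real CARD('p))) * real CARD('p) powi k)"
proof -
  note p1 = real_card_gt_1[where ?'p='p]
  have mem: "x \<in> padic_ball 0 (k - 1) \<longleftrightarrow> padic_abs x < real CARD('p) powi k" for x :: "'p padic"
    unfolding padic_abs_power_int_less_iff by (simp add: padic_ball_def)
  have "{x :: 'p padic. padic_abs x = real CARD('p) powi k} = padic_ball 0 k - padic_ball 0 (k - 1)"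
    unfolding set_eq_iff Diff_iff mem by (auto simp: padic_ball_def)
  also have "emeasure \<mu> \<dots> = emeasure \<mu> (padic_ball 0 k) - emeasure \<mu> (padic_ball 0 (k - 1))"
  proof (rule emeasure_Diff)
    show "padic_ball 0 (k - 1) \<subseteq> (padic_ball 0 k :: 'p padic set)"
      unfolding subset_iff mem by (auto simp: padic_ball_def)
  qed (auto simp: emeasure_padic_ball sets_Haar)
  also have "\<dots> = ennreal ((1 - inverse (real CARD('p))) * real CARD('p) powi k)"
    using p1 by (simp add: emeasure_padic_ball ennreal_minus power_int_diff algebra_simps divide_inverse)
  finally show ?thesis .
qed

end

section \<open>Integrals of radial functions over balls\<close>

definition radial :: "('p::prime_card padic \<Rightarrow> 'b) \<Rightarrow> bool" where
  "radial h \<longleftrightarrow> (\<forall>x y. padic_abs x = padic_abs y \<longrightarrow> h x = h y)"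

lemma radialD: "radial h \<Longrightarrow> padic_abs x = padic_abs y \<Longrightarrow> h x = h y"
  unfolding radial_def by blast

text \<open>
  A radial function takes countably many values, since \<open>padic_abs\<close> does, and its level sets are
  unions of spheres.
\<close>

lemma borel_measurable_radial:
  fixes h :: "'p::prime_card padic \<Rightarrow> ennreal"
  assumes h: "radial h" and M: "sets M = sets borel"
  shows "h \<in> borel_measurable M"
  unfolding measurable_cong_sets[OF M refl]
proof (rule measurableI)
  fix A :: "ennreal set"
  define V where "V = padic_abs ` (h -` A)"
  have "V \<subseteq> insert 0 (range (\<lambda>k. real CARD('p) powi k))"
  proof
    fix v assume "v \<in> V"
    then obtain x :: "'p padic" where "v = padic_abs x" unfolding V_def by blast
    thus "v \<in> insert 0 (range (\<lambda>k. real CARD('p) powi k))"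
      by (cases "x = 0") (auto elim: padic_abs_values)
  qed
  hence V: "countable V" by (rule countable_subset) simp
  have "h -` A = (\<Union>v\<in>V. padic_abs -` {v} \<inter> space borel)"
  proof (intro equalityI subsetI)
    fix x :: "'p padic" assume "x \<in> (\<Union>v\<in>V. padic_abs -` {v} \<inter> space borel)"
    then obtain y where "h y \<in> A" "padic_abs x = padic_abs y" by (auto simp: V_def)
    thus "x \<in> h -` A" using radialD[OF h, of x y] by simp
  qed (auto simp: V_def)
  also have "\<dots> \<in> sets borel"
    by (intro sets.countable_UN'' V measurable_sets[OF borel_measurable_padic_abs]) simp
  finally show "h -` A \<inter> space borel \<in> sets borel" by simp
qed simp

text \<open>
  Every point of an ultrametric ball is a centre of it.
\<close>

lemma padic_ball_eq_ball_0:
  assumes "padic_abs a \<le> real CARD('p) powi l"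
  shows "padic_ball (a :: 'p::prime_card padic) l = padic_ball 0 l"
proof (intro equalityI subsetI)
  fix x :: "'p padic"
  show "x \<in> padic_ball 0 l" if "x \<in> padic_ball a l"
    using that assms padic_abs_ultrametric[of "x - a" a] by (simp add: padic_ball_def)
  show "x \<in> padic_ball a l" if "x \<in> padic_ball 0 l"
    using that assms padic_abs_ultrametric[of x "- a"] by (simp add: padic_ball_def)
qed

lemma padic_abs_eq_on_far_ball:
  assumes "real CARD('p) powi l < padic_abs a" and "x \<in> padic_ball (a :: 'p::prime_card padic) l"
  shows "padic_abs x = padic_abs a"
  using assms by (intro padic_abs_eq_of_close) (simp add: padic_ball_def padic_abs_diff_commute)

context
  fixes \<mu> :: "'p::prime_card padic measure"
  assumes Haar: "normalized_Haar \<mu>"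
begin

text \<open>
  The punctured ball is the disjoint union of the spheres of radius \<open>p powi (l - n)\<close>, each
  represented here by a power of the prime; \<open>h 0 = 0\<close> accounts for the remaining point.
\<close>

lemma nn_integral_radial_ball_0:
  fixes h :: "'p padic \<Rightarrow> ennreal"
  assumes h: "radial h" "h 0 = 0"
  shows "(\<integral>\<^sup>+x\<in>padic_ball 0 l. h x \<partial>\<mu>)
    = (\<Sum>n. ennreal ((1 - inverse (real CARD('p))) * real CARD('p) powi (l - int n))
           * h (of_nat CARD('p) powi (int n - l)))"
proof -
  note p1 = real_card_gt_1[where ?'p='p]
  define S where "S n = {x :: 'p padic. padic_abs x = real CARD('p) powi (l - int n)}" for n
  have "S n \<in> sets borel" for n
    unfolding S_def by measurable
  hence S [measurable]: "S n \<in> sets \<mu>" for n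
    by (simp add: sets_Haar[OF Haar])
  have inj: "m = n" if "real CARD('p) powi (l - int m) = real CARD('p) powi (l - int n)" for m n
    using that power_int_strict_increasing[OF _ p1] by (metis diff_left_imp_eq linorder_neq_iff of_nat_eq_iff)
  have "h x * indicator (padic_ball 0 l) x
      = (\<Sum>n. h (of_nat CARD('p) powi (int n - l)) * indicator (S n) x)" for x :: "'p padic"
  proof (cases "x \<noteq> 0 \<and> x \<in> padic_ball 0 l")
    case True
    then obtain k where k: "padic_abs x = real CARD('p) powi k" by (auto elim: padic_abs_values)
    have "\<not> l < k" using True k power_int_strict_increasing[OF _ p1, of l k]
      by (auto simp: padic_ball_def)
    hence "k \<le> l" by simp
    then obtain m where m: "k = l - int m" by (metis zle_iff_zadd add_diff_cancel_right')
    have "indicator (S n) x = (if n = m then 1 else 0 :: ennreal)" for n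
      using k m inj by (auto simp: S_def indicator_def)
    hence "(\<Sum>n. h (of_nat CARD('p) powi (int n - l)) * indicator (S n) x)
        = (\<Sum>n. if n = m then h (of_nat CARD('p) powi (int n - l)) else 0)"
      by (intro suminf_cong) simp
    also have "\<dots> = h (of_nat CARD('p) powi (int m - l))"
      using sums_single[of m "\<lambda>n. h (of_nat CARD('p) powi (int n - l))"] by (simp add: sums_iff)
    also have "\<dots> = h x"
      using k m by (intro radialD[OF h(1)]) (simp add: padic_abs_prime_powi)
    finally show ?thesis using True by simp
  next
    case False
    have "x \<notin> S n \<or> h x = 0" for n
    proof (cases "x = 0")
      case True
      thus ?thesis by (simp add: h)
    next
      case x: False
      have "real CARD('p) powi (l - int n) \<le> real CARD('p) powi l"
        using p1 by (intro power_int_increasing) auto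
      thus ?thesis using False x by (auto simp: S_def padic_ball_def)
    qed
    moreover have "h (of_nat CARD('p) powi (int n - l)) = h x" if "x \<in> S n" for n
      using that by (intro radialD[OF h(1)]) (simp add: padic_abs_prime_powi S_def)
    ultimately have "h (of_nat CARD('p) powi (int n - l)) * indicator (S n) x = 0" for n
      by (cases "x \<in> S n") auto
    hence "(\<Sum>n. h (of_nat CARD('p) powi (int n - l)) * indicator (S n) x) = (\<Sum>n::nat. 0)"
      by (rule suminf_cong)
    thus ?thesis using False h(2) by auto
  qed
  hence "(\<integral>\<^sup>+x\<in>padic_ball 0 l. h x \<partial>\<mu>)
      = (\<integral>\<^sup>+x. (\<Sum>n. h (of_nat CARD('p) powi (int n - l)) * indicator (S n) x) \<partial>\<mu>)"
    by simp
  also have "\<dots> = (\<Sum>n. h (of_nat CARD('p) powi (int n - l)) * emeasure \<mu> (S n))"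
    by (subst nn_integral_suminf) (simp_all add: nn_integral_cmult_indicator)
  finally show ?thesis
    by (simp add: S_def emeasure_padic_sphere[OF Haar] mult.commute)
qed

lemma nn_integral_radial_far_ball:
  fixes h :: "'p padic \<Rightarrow> ennreal"
  assumes h: "radial h" and a: "real CARD('p) powi l < padic_abs a"
  shows "(\<integral>\<^sup>+x\<in>padic_ball a l. h x \<partial>\<mu>) = ennreal (real CARD('p) powi l) * h a"
proof -
  have "(\<integral>\<^sup>+x\<in>padic_ball a l. h x \<partial>\<mu>) = (\<integral>\<^sup>+x\<in>padic_ball a l. h a \<partial>\<mu>)"
    using radialD[OF h padic_abs_eq_on_far_ball[OF a]]
    by (intro nn_integral_cong) (auto simp: indicator_def)
  thus ?thesis
    by (simp add: nn_integral_cmult_indicator sets_Haar[OF Haar] emeasure_padic_ball[OF Haar] mult.commute)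
qed

text \<open>
  The change of variables \<open>y = w * x\<close>. For radial integrands both sides are explicit: by the
  sphere decomposition if the ball contains \<open>0\<close>, and because the integrand is constant on the ball
  otherwise.
\<close>

lemma nn_integral_radial_dilate:
  fixes h :: "'p padic \<Rightarrow> ennreal"
  assumes h: "radial h" "h 0 = 0" and w: "padic_abs w = real CARD('p) powi (- j)"
  shows "(\<integral>\<^sup>+x\<in>padic_ball a l. h (w * x) \<partial>\<mu>)
    = ennreal (real CARD('p) powi j) * (\<integral>\<^sup>+x\<in>padic_ball (w * a) (l - j). h x \<partial>\<mu>)"
proof -
  note p1 = real_card_gt_1[where ?'p='p]
  have p_add: "real CARD('p) powi (m + n) = real CARD('p) powi m * real CARD('p) powi n" for m n
    using p1 by (simp add: power_int_add)
  have pos: "real CARD('p) powi m > 0" for m using p1 by simp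
  have hw: "radial (\<lambda>x. h (w * x))" "h (w * 0) = 0"
    unfolding radial_def by (auto intro: radialD[OF h(1)] simp: padic_abs_mult h(2))
  have wa: "padic_abs (w * a) = real CARD('p) powi (- j) * padic_abs a"
    by (simp add: padic_abs_mult w)
  have l: "real CARD('p) powi (l - j) = real CARD('p) powi (- j) * real CARD('p) powi l"
    using p_add[of "- j" l] by simp
  show ?thesis
  proof (cases "padic_abs a \<le> real CARD('p) powi l")
    case True
    hence wl: "padic_abs (w * a) \<le> real CARD('p) powi (l - j)"
      unfolding wa l using pos by simp
    have "(\<integral>\<^sup>+x\<in>padic_ball (w * a) (l - j). h x \<partial>\<mu>)
      = (\<Sum>n. ennreal ((1 - inverse (real CARD('p))) * real CARD('p) powi (l - j - int n))
           * h (of_nat CARD('p) powi (int n - (l - j))))"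
      by (simp only: padic_ball_eq_ball_0[OF wl] nn_integral_radial_ball_0[OF h])
    hence "ennreal (real CARD('p) powi j) * (\<integral>\<^sup>+x\<in>padic_ball (w * a) (l - j). h x \<partial>\<mu>)
      = (\<Sum>n. ennreal (real CARD('p) powi j)
           * (ennreal ((1 - inverse (real CARD('p))) * real CARD('p) powi (l - j - int n))
           * h (of_nat CARD('p) powi (int n - (l - j)))))"
      by simp
    also have "\<dots> = (\<Sum>n. ennreal ((1 - inverse (real CARD('p))) * real CARD('p) powi (l - int n))
           * h (w * of_nat CARD('p) powi (int n - l)))"
    proof (rule suminf_cong)
      fix n
      have 1: "h (w * of_nat CARD('p) powi (int n - l)) = h (of_nat CARD('p) powi (int n - (l - j)))"
        by (rule radialD[OF h(1)], unfold padic_abs_mult padic_abs_prime_powi w p_add[symmetric],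
            rule arg_cong[of _ _ "power_int _"]) simp
      have "real CARD('p) powi (l - int n) = real CARD('p) powi j * real CARD('p) powi (l - j - int n)"
        unfolding p_add[symmetric] by (rule arg_cong[of _ _ "power_int _"]) simp
      hence "(1 - inverse (real CARD('p))) * real CARD('p) powi (l - int n)
          = real CARD('p) powi j * ((1 - inverse (real CARD('p))) * real CARD('p) powi (l - j - int n))"
        by (simp only: mult.left_commute)
      moreover have "0 \<le> 1 - inverse (real CARD('p))"
        using p1 by (simp add: inverse_le_1_iff)
      ultimately have "ennreal ((1 - inverse (real CARD('p))) * real CARD('p) powi (l - int n))
          = ennreal (real CARD('p) powi j)
            * ennreal ((1 - inverse (real CARD('p))) * real CARD('p) powi (l - j - int n))"
        using pos by (simp only: ennreal_mult mult_nonneg_nonneg less_imp_le)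
      thus "ennreal (real CARD('p) powi j)
           * (ennreal ((1 - inverse (real CARD('p))) * real CARD('p) powi (l - j - int n))
           * h (of_nat CARD('p) powi (int n - (l - j))))
         = ennreal ((1 - inverse (real CARD('p))) * real CARD('p) powi (l - int n))
           * h (w * of_nat CARD('p) powi (int n - l))"
        unfolding 1 by (simp only: mult.assoc)
    qed
    also have "\<dots> = (\<integral>\<^sup>+x\<in>padic_ball a l. h (w * x) \<partial>\<mu>)"
      by (simp only: padic_ball_eq_ball_0[OF True] nn_integral_radial_ball_0[OF hw])
    finally show ?thesis ..
  next
    case False
    hence "real CARD('p) powi (l - j) < padic_abs (w * a)"
      unfolding wa l using pos by simp
    moreover have "real CARD('p) powi l = real CARD('p) powi j * real CARD('p) powi (l - j)"
      using p_add[of j "l - j"] by simp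
    ultimately show ?thesis using False h hw pos
      by (simp add: nn_integral_radial_far_ball ennreal_mult less_imp_le mult.assoc)
  qed
qed

end

section \<open>Minkowski's inequality for countable sums\<close>

lemma ennreal_powr_ennreal: "x \<ge> 0 \<Longrightarrow> ennreal_powr (ennreal x) s = ennreal (x powr s)"
  by (simp add: ennreal_powr_def)

lemma ennreal_powr_infinity [unfolded infinity_ennreal_def, simp]: "ennreal_powr \<infinity> s = \<infinity>"
  by (simp add: ennreal_powr_def)

lemma ennreal_powr_0 [simp]: "ennreal_powr 0 s = 0"
  by (simp add: ennreal_powr_def)

lemma ennreal_powr_mono:
  assumes "x \<le> y" "s > 0"
  shows "ennreal_powr x s \<le> ennreal_powr y s"
  using assms by (cases x; cases y)
    (auto simp: ennreal_powr_ennreal powr_mono2 top_unique)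

lemma ennreal_powr_inverse:
  assumes "s > 0"
  shows "ennreal_powr (ennreal_powr x s) (1 / s) = x" "ennreal_powr (ennreal_powr x (1 / s)) s = x"
  using assms by (cases x; auto simp: ennreal_powr_ennreal powr_powr)+

lemma ennreal_powr_le_iff:
  assumes "s > 0"
  shows "ennreal_powr x s \<le> y \<longleftrightarrow> x \<le> ennreal_powr y (1 / s)"
  using assms ennreal_powr_mono[of "ennreal_powr x s" y "1 / s"]
    ennreal_powr_mono[of x "ennreal_powr y (1 / s)" s]
  by (auto simp: ennreal_powr_inverse)

lemma ennreal_powr_mult:
  assumes "s > 0"
  shows "ennreal_powr (x * y) s = ennreal_powr x s * ennreal_powr y s"
proof (cases "x = \<infinity> \<or> y = \<infinity>")
  case True
  have "ennreal_powr z s = 0 \<longleftrightarrow> z = 0" for z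
    by (cases z) (auto simp: ennreal_powr_ennreal)
  with True show ?thesis
    by (elim disjE) (simp_all add: ennreal_top_mult ennreal_mult_top)
next
  case False
  then obtain a b where "x = ennreal a" "y = ennreal b" "a \<ge> 0" "b \<ge> 0"
    by (cases x; cases y) auto
  thus ?thesis by (simp add: ennreal_powr_ennreal powr_mult flip: ennreal_mult)
qed

lemma borel_measurable_ennreal_powr [measurable (raw)]:
  assumes [measurable]: "f \<in> borel_measurable M"
  shows "(\<lambda>x. ennreal_powr (f x) s) \<in> borel_measurable M"
  unfolding ennreal_powr_def by measurable

text \<open>
  Jensen's inequality for \<open>\<lambda>x. x powr r\<close> with the weights \<open>d j / sum d J\<close>. Convexity is used on the
  positive reals, hence the restriction to the indices with \<open>a j \<noteq> 0\<close>; enlarging the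
  total weight afterwards is harmless because \<open>r - 1 \<ge> 0\<close>.
\<close>

lemma powr_weighted_sum_le:
  fixes d a :: "'i \<Rightarrow> real"
  assumes J: "finite J" and d: "\<And>j. j \<in> J \<Longrightarrow> d j > 0" and a: "\<And>j. j \<in> J \<Longrightarrow> a j \<ge> 0"
    and r: "r \<ge> 1"
  shows "(\<Sum>j\<in>J. d j * a j) powr r \<le> (\<Sum>j\<in>J. d j) powr (r - 1) * (\<Sum>j\<in>J. d j * a j powr r)"
proof -
  define P where "P = {j \<in> J. a j \<noteq> 0}"
  have P: "finite P" "P \<subseteq> J" using J by (auto simp: P_def)
  have aP: "a j > 0" if "j \<in> P" for j using that a[of j] by (auto simp: P_def order_less_le)
  have eq1: "(\<Sum>j\<in>J. d j * a j) = (\<Sum>j\<in>P. d j * a j)"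
    using J by (intro sum.mono_neutral_right) (auto simp: P_def)
  have eq2: "(\<Sum>j\<in>J. d j * a j powr r) = (\<Sum>j\<in>P. d j * a j powr r)"
    using J by (intro sum.mono_neutral_right) (auto simp: P_def)
  show ?thesis
  proof (cases "P = {}")
    case False
    define D where "D = (\<Sum>j\<in>P. d j)"
    have D: "D > 0" unfolding D_def using False P d by (intro sum_pos) auto
    have "(\<Sum>j\<in>P. (d j / D) *\<^sub>R a j) powr r \<le> (\<Sum>j\<in>P. (d j / D) * a j powr r)"
    proof (rule convex_on_sum[OF P(1) False powr_convex[OF r]])
      show "(\<Sum>j\<in>P. d j / D) = 1"
        using D by (simp add: D_def flip: sum_divide_distrib)
      show "\<And>j. j \<in> P \<Longrightarrow> 0 \<le> d j / D" using P d D by (auto simp: less_imp_le)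
    qed (simp add: aP)
    also have "(\<Sum>j\<in>P. (d j / D) *\<^sub>R a j) = (\<Sum>j\<in>P. d j * a j) / D"
      by (simp add: sum_divide_distrib)
    also have "(\<Sum>j\<in>P. (d j / D) * a j powr r) = (\<Sum>j\<in>P. d j * a j powr r) / D"
      by (simp add: sum_divide_distrib)
    also have "((\<Sum>j\<in>P. d j * a j) / D) powr r = (\<Sum>j\<in>P. d j * a j) powr r / D powr r"
      by (simp add: powr_divide)
    finally have "(\<Sum>j\<in>P. d j * a j) powr r \<le> D powr r * ((\<Sum>j\<in>P. d j * a j powr r) / D)"
      using D by (simp add: divide_simps mult.commute)
    also have "\<dots> = D powr (r - 1) * (\<Sum>j\<in>P. d j * a j powr r)"
      using D by (simp add: powr_diff)
    also have "\<dots> \<le> (\<Sum>j\<in>J. d j) powr (r - 1) * (\<Sum>j\<in>P. d j * a j powr r)"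
      unfolding D_def using P d J r
      by (intro mult_right_mono powr_mono2 sum_mono2 sum_nonneg) (auto simp: less_imp_le)
    finally show ?thesis unfolding eq1 eq2 .
  qed (simp add: eq1 eq2)
qed

text \<open>
  The countable version follows from the finite one by bounding the partial sums. Taking \<open>r\<close>-th roots
  first turns the claim into a bound on a series, to which \<open>suminf_le_const\<close> applies.
\<close>

lemma ennreal_powr_weighted_suminf_le:
  fixes d :: "nat \<Rightarrow> real" and a :: "nat \<Rightarrow> ennreal"
  assumes d: "\<And>j. d j > 0" and sd: "summable d" and r: "r \<ge> 1"
  shows "ennreal_powr (\<Sum>j. ennreal (d j) * a j) r
    \<le> ennreal (suminf d powr (r - 1)) * (\<Sum>j. ennreal (d j) * ennreal_powr (a j) r)"
    (is "_ \<le> ?R")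
proof -
  have r0: "r > 0" using r by simp
  \<comment> \<open>An infinite term makes the right-hand side infinite; otherwise all terms are real.\<close>
  have "(\<Sum>j<n. ennreal (d j) * a j) \<le> ennreal_powr ?R (1 / r)" for n
  proof (cases "\<exists>j<n. a j = \<infinity>")
    case True
    then obtain j where j: "a j = \<infinity>" by auto
    have "\<infinity> = ennreal (d j) * ennreal_powr (a j) r" using d[of j] by (simp add: j ennreal_mult_top)
    also have "\<dots> = (\<Sum>i\<in>{j}. ennreal (d i) * ennreal_powr (a i) r)" by simp
    also have "\<dots> \<le> (\<Sum>i. ennreal (d i) * ennreal_powr (a i) r)"
      by (intro sum_le_suminf) auto
    finally have "(\<Sum>i. ennreal (d i) * ennreal_powr (a i) r) = \<infinity>" by (simp add: top_unique)
    moreover have "suminf d > 0" using sd d by (intro suminf_pos)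
    ultimately have "?R = \<infinity>" by (simp add: ennreal_mult_top)
    thus ?thesis by simp
  next
    case False
    define b where "b j = enn2real (a j)" for j
    have b: "a j = ennreal (b j)" "b j \<ge> 0" if "j < n" for j
      using False that by (auto simp: b_def less_top)
    have "(\<Sum>j<n. ennreal (d j) * a j) = (\<Sum>j<n. ennreal (d j * b j))"
      using b d by (intro sum.cong) (auto simp: less_imp_le ennreal_mult)
    also have "\<dots> = ennreal (\<Sum>j<n. d j * b j)"
      using b d by (intro sum_ennreal) (auto simp: less_imp_le)
    finally have eq: "(\<Sum>j<n. ennreal (d j) * a j) = ennreal (\<Sum>j<n. d j * b j)" .
    have "ennreal_powr (\<Sum>j<n. ennreal (d j) * a j) r = ennreal ((\<Sum>j<n. d j * b j) powr r)"
      unfolding eq using b d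
      by (intro ennreal_powr_ennreal sum_nonneg) (auto simp: less_imp_le)
    also have "\<dots> \<le> ennreal ((\<Sum>j<n. d j) powr (r - 1) * (\<Sum>j<n. d j * b j powr r))"
      using b d r by (intro ennreal_leI powr_weighted_sum_le) auto
    also have "\<dots> \<le> ennreal (suminf d powr (r - 1) * (\<Sum>j<n. d j * b j powr r))"
      using d sd r by (intro ennreal_leI mult_right_mono powr_mono2 sum_le_suminf sum_nonneg)
         (auto simp: less_imp_le)
    also have "\<dots> = ennreal (suminf d powr (r - 1)) * ennreal (\<Sum>j<n. d j * b j powr r)"
      using d by (intro ennreal_mult sum_nonneg) (auto simp: less_imp_le)
    also have "ennreal (\<Sum>j<n. d j * b j powr r) = (\<Sum>j<n. ennreal (d j * b j powr r))"
      using d by (intro sum_ennreal[symmetric]) (auto simp: less_imp_le)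
    also have "\<dots> = (\<Sum>j<n. ennreal (d j) * ennreal_powr (a j) r)"
      using b d by (intro sum.cong) (auto simp: less_imp_le ennreal_powr_ennreal ennreal_mult)
    also have "ennreal (suminf d powr (r - 1)) * \<dots> \<le> ?R"
      by (intro mult_left_mono sum_le_suminf) auto
    finally show ?thesis using r0 by (simp add: ennreal_powr_le_iff)
  qed
  hence "(\<Sum>j. ennreal (d j) * a j) \<le> ennreal_powr ?R (1 / r)"
    by (intro suminf_le_const) auto
  thus ?thesis using r0 by (simp add: ennreal_powr_le_iff)
qed

text \<open>
  Minkowski's inequality \<open>\<parallel>\<Sum>j. g j\<parallel> \<le> (\<Sum>j. \<parallel>g j\<parallel>)\<close> in \<open>L\<^sup>r\<close>, for functions with
  \<open>\<parallel>g j\<parallel> \<le> d j * K powr (1 / r)\<close>. The functions \<open>g j / d j\<close> have \<open>r\<close>-th powers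
  with integral at most \<open>K\<close>, so Jensen's inequality for them with weights \<open>d j\<close> can be integrated term by
  term.
\<close>

lemma nn_integral_powr_suminf_le:
  fixes d :: "nat \<Rightarrow> real" and g :: "nat \<Rightarrow> 'a \<Rightarrow> ennreal"
  assumes d: "\<And>j. d j > 0" and sd: "summable d" and r: "r \<ge> 1"
    and g [measurable]: "\<And>j. g j \<in> borel_measurable M"
    and bound: "\<And>j. (\<integral>\<^sup>+x. ennreal_powr (g j x) r \<partial>M) \<le> ennreal (d j powr r) * K"
  shows "(\<integral>\<^sup>+x. ennreal_powr (\<Sum>j. g j x) r \<partial>M) \<le> ennreal (suminf d powr r) * K"
proof -
  have r0: "r > 0" using r by simp
  have D: "suminf d > 0" using sd d by (intro suminf_pos)
  define a where "a j x = ennreal (1 / d j) * g j x" for j x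
  have ga: "g j x = ennreal (d j) * a j x" for j x
    using d[of j] by (simp add: a_def less_imp_le flip: mult.assoc ennreal_mult)
  have a_powr: "ennreal (d j) * ennreal_powr (a j x) r
      = ennreal (d j powr (1 - r)) * ennreal_powr (g j x) r" for j x
    using d[of j] r0
    by (simp add: a_def ennreal_powr_mult ennreal_powr_ennreal less_imp_le powr_diff powr_divide
        flip: mult.assoc ennreal_mult)
  have "(\<integral>\<^sup>+x. ennreal_powr (\<Sum>j. g j x) r \<partial>M)
      \<le> (\<integral>\<^sup>+x. ennreal (suminf d powr (r - 1)) * (\<Sum>j. ennreal (d j powr (1 - r)) * ennreal_powr (g j x) r) \<partial>M)"
  proof (rule nn_integral_mono)
    fix x
    show "ennreal_powr (\<Sum>j. g j x) r
        \<le> ennreal (suminf d powr (r - 1)) * (\<Sum>j. ennreal (d j powr (1 - r)) * ennreal_powr (g j x) r)"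
      using ennreal_powr_weighted_suminf_le[OF d sd r, of "\<lambda>j. a j x"]
      unfolding a_powr ga[symmetric] .
  qed
  also have "\<dots> = ennreal (suminf d powr (r - 1))
      * (\<Sum>j. ennreal (d j powr (1 - r)) * (\<integral>\<^sup>+x. ennreal_powr (g j x) r \<partial>M))"
    by (simp add: nn_integral_cmult nn_integral_suminf)
  also have "\<dots> \<le> ennreal (suminf d powr (r - 1))
      * (\<Sum>j. ennreal (d j powr (1 - r)) * (ennreal (d j powr r) * K))"
    by (intro mult_left_mono suminf_le mult_left_mono bound) auto
  also have "(\<lambda>j. ennreal (d j powr (1 - r)) * (ennreal (d j powr r) * K)) = (\<lambda>j. ennreal (d j) * K)"
    using d by (simp add: fun_eq_iff less_imp_le flip: mult.assoc ennreal_mult powr_add)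
  also have "(\<Sum>j. ennreal (d j) * K) = ennreal (suminf d) * K"
    using d sd by (simp add: suminf_ennreal2 less_imp_le)
  also have "ennreal (suminf d powr (r - 1)) * (ennreal (suminf d) * K) = ennreal (suminf d powr r) * K"
    using D by (simp add: powr_diff less_imp_le flip: mult.assoc ennreal_mult)
  finally show ?thesis .
qed

lemma ennreal_mult_le_iff:
  assumes "u > 0"
  shows "ennreal u * x \<le> y \<longleftrightarrow> x \<le> ennreal (1 / u) * y"
proof
  have 1: "ennreal (1 / u) * (ennreal u * z) = z" "ennreal u * (ennreal (1 / u) * z) = z" for z
    using assms by (simp_all add: less_imp_le flip: mult.assoc ennreal_mult)
  show "x \<le> ennreal (1 / u) * y" if "ennreal u * x \<le> y"
    using mult_left_mono[OF that zero_le[of "ennreal (1 / u)"]] by (simp only: 1)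
  show "ennreal u * x \<le> y" if "x \<le> ennreal (1 / u) * y"
    using mult_left_mono[OF that zero_le[of "ennreal u"]] by (simp only: 1)
qed

text \<open>
  Translates a bound on the normalized \<open>L\<^sup>r\<close> norm in the definition of \<open>Cesaro_Morrey_norm\<close>, where
  \<open>u\<close> is the power of the measure of the ball, into one on the integral of the \<open>r\<close>-th power.
\<close>

lemma normalized_powr_le_iff:
  assumes "u > 0" "r > 0"
  shows "ennreal u * ennreal_powr I (1 / r) \<le> M \<longleftrightarrow> I \<le> ennreal (u powr (- r)) * ennreal_powr M r"
proof -
  have "ennreal u * ennreal_powr I (1 / r) \<le> M \<longleftrightarrow> I \<le> ennreal_powr (ennreal (1 / u) * M) r"
    using assms ennreal_powr_le_iff[of "1 / r" I] by (simp add: ennreal_mult_le_iff)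
  also have "ennreal_powr (ennreal (1 / u) * M) r = ennreal (u powr (- r)) * ennreal_powr M r"
    using assms
    by (simp add: ennreal_powr_mult ennreal_powr_ennreal powr_divide powr_minus_divide less_imp_le)
  finally show ?thesis .
qed

section \<open>The Hardy operator as a series of dilations\<close>

lemma radial_Cesaro_mean: "radial (Cesaro_mean \<mu> \<beta> f)"
  unfolding radial_def Cesaro_mean_def by (intro allI impI) simp

lemma Cesaro_mean_0 [simp]: "Cesaro_mean \<mu> \<beta> f 0 = 0"
  by (simp add: Cesaro_mean_def)

text \<open>
  Where \<open>f\<close> is not integrable, the Bochner integral is \<open>0\<close> by convention and the bound is trivial.
\<close>

lemma norm_padic_Hardy_le:
  "ennreal (norm (padic_Hardy \<mu> f x)) \<le> Cesaro_mean \<mu> 0 f x"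
proof -
  define B where "B = {y :: 'a padic. padic_abs y \<le> padic_abs x}"
  have "ennreal (norm (LINT y:B|\<mu>. f y)) \<le> (\<integral>\<^sup>+y\<in>B. ennreal (norm (f y)) \<partial>\<mu>)"
  proof (cases "set_integrable \<mu> B f")
    case True
    hence "ennreal (norm (LINT y:B|\<mu>. f y)) \<le> (\<integral>\<^sup>+y. ennreal (norm (indicator B y *\<^sub>R f y)) \<partial>\<mu>)"
      unfolding set_integrable_def set_lebesgue_integral_def by (rule integral_norm_bound_ennreal)
    also have "\<dots> = (\<integral>\<^sup>+y\<in>B. ennreal (norm (f y)) \<partial>\<mu>)"
      by (intro nn_integral_cong) (auto simp: indicator_def)
    finally show ?thesis .
  next
    case False
    thus ?thesis
      by (simp add: set_integrable_def set_lebesgue_integral_def not_integrable_integral_eq)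
  qed
  hence "ennreal (1 / padic_abs x) * ennreal (norm (LINT y:B|\<mu>. f y)) \<le>
      ennreal (1 / padic_abs x) * (\<integral>\<^sup>+y\<in>B. ennreal (norm (f y)) \<partial>\<mu>)"
    by (rule mult_left_mono) simp
  thus ?thesis
    by (simp add: padic_Hardy_def Cesaro_mean_def B_def flip: ennreal_mult)
qed

text \<open>
  Write \<open>\<bar>x\<bar> = p powi k\<close>. The sphere of radius \<open>p powi (k - n)\<close> contributes its measure times the value there
  of the Cesaro mean with \<open>\<beta> = 0\<close>. This value and that of the Cesaro mean for \<open>\<beta>\<close> at \<open>p ^ n * x\<close>, a point of
  the same sphere, contain the same integral of \<open>\<bar>f\<bar>\<close>, so only powers of \<open>p\<close> have to be compared.
\<close>

lemma Cesaro_mean_padic_Hardy_le: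
  fixes \<mu> :: "'p::prime_card padic measure"
  assumes Haar: "normalized_Haar \<mu>"
  shows "Cesaro_mean \<mu> \<beta> (padic_Hardy \<mu> f) x
    \<le> (\<Sum>n. ennreal ((1 - inverse (real CARD('p))) * real CARD('p) powr (- (real n * (1 - \<beta>))))
           * Cesaro_mean \<mu> \<beta> f (of_nat CARD('p) powi int n * x))"
proof (cases "x = 0")
  case False
  define P where "P = real CARD('p)"
  define c where "c = 1 - inverse P"
  have P: "P > 1" unfolding P_def by (rule real_card_gt_1)
  have c: "c \<ge> 0" using P by (simp add: c_def inverse_le_1_iff)
  obtain k where k: "padic_abs x = P powi k" using False unfolding P_def by (rule padic_abs_values)
  have Pk: "P powi m = P powr of_int m" for m using P by (simp add: powr_real_of_int')
  let ?H = "Cesaro_mean \<mu> 0 f" and ?w = "of_nat CARD('p) :: 'p padic"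
  have ball: "{t :: 'p padic. padic_abs t \<le> padic_abs x} = padic_ball 0 k"
    by (simp add: padic_ball_def k P_def)
  have "Cesaro_mean \<mu> \<beta> (padic_Hardy \<mu> f) x
      \<le> ennreal (1 / padic_abs x powr (1 - \<beta>)) * (\<integral>\<^sup>+t\<in>padic_ball 0 k. ?H t \<partial>\<mu>)"
    unfolding Cesaro_mean_def[of _ \<beta>] ball
    by (intro mult_left_mono nn_integral_mono mult_right_mono norm_padic_Hardy_le) auto
  also have "(\<integral>\<^sup>+t\<in>padic_ball 0 k. ?H t \<partial>\<mu>)
      = (\<Sum>n. ennreal (c * P powi (k - int n)) * ?H (?w powi (int n - k)))"
    unfolding c_def P_def by (intro nn_integral_radial_ball_0 Haar radial_Cesaro_mean Cesaro_mean_0)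
  also have "ennreal (1 / padic_abs x powr (1 - \<beta>)) * \<dots>
      = (\<Sum>n. ennreal (1 / padic_abs x powr (1 - \<beta>))
           * (ennreal (c * P powi (k - int n)) * ?H (?w powi (int n - k))))"
    by simp
  also have "\<dots> = (\<Sum>n. ennreal (c * P powr (- (real n * (1 - \<beta>)))) * Cesaro_mean \<mu> \<beta> f (?w powi int n * x))"
  proof (rule suminf_cong)
    fix n
    let ?k = "k - int n"
    define G where "G = (\<integral>\<^sup>+t\<in>padic_ball 0 ?k. ennreal (norm (f t)) \<partial>\<mu>)"
    have abs1: "padic_abs (?w powi (int n - k)) = P powi ?k"
      by (simp add: padic_abs_prime_powi P_def)
    have abs2: "padic_abs (?w powi int n * x) = P powi ?k"
      unfolding padic_abs_mult padic_abs_prime_powi k using P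
      by (simp add: power_int_minus power_int_diff divide_inverse flip: P_def)
    have G: "(\<integral>\<^sup>+t\<in>{t. padic_abs t \<le> P powi ?k}. ennreal (norm (f t)) \<partial>\<mu>) = G"
      by (simp add: G_def padic_ball_def P_def)
    have "1 / padic_abs x powr (1 - \<beta>) * (c * P powi ?k) * (1 / (P powi ?k) powr (1 - 0))
        = c * P powr (- (real n * (1 - \<beta>))) * (1 / (P powi ?k) powr (1 - \<beta>))"
    proof -
      have "1 / padic_abs x powr (1 - \<beta>) = P powr (- (of_int k * (1 - \<beta>)))"
        unfolding k Pk powr_powr by (simp add: powr_minus_divide)
      moreover have "P powr (- (real n * (1 - \<beta>))) * (1 / (P powi ?k) powr (1 - \<beta>))
          = P powr (- (of_int k * (1 - \<beta>)))"
      proof -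
        have "1 / (P powi ?k) powr (1 - \<beta>) = P powr (- (of_int ?k * (1 - \<beta>)))"
          unfolding Pk powr_powr by (simp add: powr_minus_divide)
        thus ?thesis by (simp flip: powr_add) (simp add: algebra_simps)
      qed
      moreover have "P powi ?k * (1 / (P powi ?k) powr (1 - 0)) = 1"
        using P by simp
      ultimately show ?thesis
        by (metis (no_types, lifting) mult.assoc mult.commute mult.right_neutral)
    qed
    hence "ennreal (1 / padic_abs x powr (1 - \<beta>)) * ennreal (c * P powi ?k) * ennreal (1 / (P powi ?k) powr (1 - 0))
        = ennreal (c * P powr (- (real n * (1 - \<beta>)))) * ennreal (1 / (P powi ?k) powr (1 - \<beta>))"
      using c P by (simp flip: ennreal_mult)
    thus "ennreal (1 / padic_abs x powr (1 - \<beta>)) * (ennreal (c * P powi ?k) * ?H (?w powi (int n - k)))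
        = ennreal (c * P powr (- (real n * (1 - \<beta>)))) * Cesaro_mean \<mu> \<beta> f (?w powi int n * x)"
      unfolding Cesaro_mean_def abs1 abs2 G mult.assoc[symmetric] by (simp only:)
  qed
  finally show ?thesis unfolding c_def P_def .
qed simp

section \<open>The constant as a geometric series\<close>

text \<open>
  The kernel \<open>Hardy_kernel 1 (p powi j)\<close> is the indicator of \<open>j \<le> 0\<close>, so the sum over the integers is the
  geometric series with ratio \<open>p powr - (1 - \<beta> - 1 / q)\<close>.
\<close>

lemma Hardy_const_series:
  fixes p :: nat and \<beta> q :: real
  assumes p: "p > 1" and \<beta>: "\<beta> < 1 - 1 / q"
  defines "d \<equiv> \<lambda>n. (1 - inverse (real p)) * real p powr (- (real n * (1 - \<beta> - 1 / q)))"
  shows "summable d" "Hardy_const p \<beta> q = suminf d" "d n > 0"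
proof -
  define s where "s = 1 - \<beta> - 1 / q"
  define e where "e n = real p powr (- (real n * s))" for n :: nat
  have s: "s > 0" using \<beta> by (simp add: s_def)
  have "e = (\<lambda>n. (real p powr (- s)) ^ n)"
    unfolding fun_eq_iff using p by (simp add: e_def powr_powr mult.commute flip: powr_realpow)
  moreover have "real p powr (- s) < 1"
    using p s by (simp add: powr_less_one)
  ultimately have e: "summable e"
    using summable_geometric[of "real p powr (- s)"] by simp
  have d: "d = (\<lambda>n. (1 - inverse (real p)) * e n)"
    by (simp add: d_def e_def s_def)
  show "summable d" unfolding d using e by (rule summable_mult)
  show "d n > 0" unfolding d e_def using p by (simp add: inverse_less_1_iff)
  have "(\<Sum>\<^sub>\<infinity>j\<in>(UNIV :: int set). Hardy_kernel 1 (real p powi j) * real p powr (of_int j * s))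
      = (\<Sum>\<^sub>\<infinity>j\<in>range (\<lambda>n. - int n). real p powr (of_int j * s))"
  proof (rule infsum_cong_neutral)
    fix j :: int
    assume j: "j \<in> UNIV - range (\<lambda>n. - int n)"
    have "j > 0"
    proof (rule ccontr)
      assume "\<not> j > 0"
      hence "j = - int (nat (- j))" by simp
      thus False using j by blast
    qed
    hence "real p powi 0 < real p powi j" using p by (intro power_int_strict_increasing) auto
    thus "Hardy_kernel 1 (real p powi j) * real p powr (of_int j * s) = 0"
      by (simp add: Hardy_kernel_def)
  next
    fix j :: int
    assume "j \<in> UNIV \<inter> range (\<lambda>n. - int n)"
    then obtain n where j: "j = - int n" by blast
    have "real p powi j \<le> real p powi 0" unfolding j using p by (intro power_int_increasing) auto
    thus "Hardy_kernel 1 (real p powi j) * real p powr (of_int j * s) = real p powr (of_int j * s)"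
      using p by (simp add: Hardy_kernel_def)
  qed simp
  also have "\<dots> = (\<Sum>\<^sub>\<infinity>n\<in>(UNIV :: nat set). e n)"
    by (subst infsum_reindex) (auto simp: inj_on_def o_def e_def[abs_def])
  also have "\<dots> = suminf e"
  proof (intro infsumI norm_summable_imp_has_sum summable_sums e)
    have "norm (e n) = e n" for n by (simp add: e_def)
    thus "summable (\<lambda>n. norm (e n))" using e by simp
  qed
  finally show "Hardy_const p \<beta> q = suminf d"
    unfolding Hardy_const_def d suminf_mult[OF e] by (simp add: s_def)
qed

section \<open>Boundedness of the Hardy operator\<close>

theorem theorem15:
  fixes \<mu> :: "'p::prime_card padic measure"
    and f :: "'p padic \<Rightarrow> complex"
    and r q \<beta> :: real
  assumes "normalized_Haar \<mu>"
    and "1 \<le> r" and "r \<le> q"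
    and "0 \<le> \<beta>" and "\<beta> < 1 - 1 / q"
    and "f \<in> Cesaro_Morrey_space \<mu> \<beta> r q"
  shows "Cesaro_Morrey_norm \<mu> \<beta> r q (padic_Hardy \<mu> f)
       \<le> ennreal (Hardy_const CARD('p) \<beta> q) * Cesaro_Morrey_norm \<mu> \<beta> r q f"
proof -
  note Haar = assms(1)
  define P where "P = real CARD('p)"
  define c where "c = 1 - inverse P"
  define d where "d n = c * P powr (- (real n * (1 - \<beta> - 1 / q)))" for n
  define M where "M = Cesaro_Morrey_norm \<mu> \<beta> r q f"
  define F where "F = Cesaro_mean \<mu> \<beta> f"
  \<comment> \<open>\<open>u l\<close> is the weight of a ball of radius \<open>p powi l\<close> in the Morrey norm.\<close>
  define u where "u l = P powr (of_int l * (1 / q - 1 / r))" for l :: int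
  define g where "g n x = ennreal (c * P powr (- (real n * (1 - \<beta>)))) * F (of_nat CARD('p) powi int n * x)"
    for n x
  have P: "P > 1" unfolding P_def by (rule real_card_gt_1)
  have c: "c > 0" using P by (simp add: c_def inverse_less_1_iff)
  have r: "r > 0" using assms(2) by simp
  have Pk: "P powi m = P powr of_int m" for m using P by (simp add: powr_real_of_int')
  have p: "1 < CARD('p)" using P by (simp add: P_def)
  have d: "summable d" "Hardy_const CARD('p) \<beta> q = suminf d" "\<And>n. d n > 0"
    using Hardy_const_series[OF p assms(5)] by (simp_all add: d_def[abs_def] c_def P_def)
  have u: "measure \<mu> (padic_ball a l) powr (1 / q - 1 / r) = u l" for a l
    unfolding measure_padic_ball[OF Haar] P_def[symmetric] Pk u_def powr_powr ..
  have u0: "u l > 0" for l using P by (simp add: u_def)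
  have F: "radial F" "F 0 = 0" by (simp_all add: F_def radial_Cesaro_mean)
  have F_bound: "(\<integral>\<^sup>+x\<in>padic_ball a l. ennreal_powr (F x) r \<partial>\<mu>)
      \<le> ennreal (u l powr (- r)) * ennreal_powr M r" for a l
  proof -
    have "ennreal (u l) * ennreal_powr (\<integral>\<^sup>+x\<in>padic_ball a l. ennreal_powr (F x) r \<partial>\<mu>) (1 / r) \<le> M"
      unfolding M_def Cesaro_Morrey_norm_def F_def
      by (rule SUP_upper2[of "(a, l)"]) (simp_all add: u)
    thus ?thesis by (simp add: normalized_powr_le_iff u0 r)
  qed
  have g_meas: "g n \<in> borel_measurable \<mu>" for n
  proof -
    have "radial (g n)"
      unfolding radial_def g_def by (auto intro!: arg_cong2[of _ _ _ _ times] radialD[OF F(1)] simp: padic_abs_mult)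
    thus ?thesis by (rule borel_measurable_radial[OF _ sets_Haar[OF Haar]])
  qed
  \<comment> \<open>Dilation by \<open>p ^ n\<close> costs the factor \<open>p powr (n / q)\<close>, which turns the exponent
    \<open>1 - \<beta>\<close> of \<open>g n\<close> into the exponent \<open>1 - \<beta> - 1 / q\<close> of \<open>d n\<close>.\<close>
  have g_bound: "(\<integral>\<^sup>+x\<in>padic_ball a l. ennreal_powr (g n x) r \<partial>\<mu>)
      \<le> ennreal (d n powr r) * (ennreal (u l powr (- r)) * ennreal_powr M r)" for n a l
  proof -
    let ?w = "of_nat CARD('p) powi int n :: 'p padic"
    let ?b = "c * P powr (- (real n * (1 - \<beta>)))"
    have h: "radial (\<lambda>x. ennreal_powr (F x) r)" "ennreal_powr (F 0) r = 0"
      unfolding radial_def by (auto dest: radialD[OF F(1)] simp: F(2))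
    have meas: "(\<lambda>x. ennreal_powr (F (?w * x)) r * indicator (padic_ball a l) x) \<in> borel_measurable \<mu>"
    proof (rule borel_measurable_times_ennreal)
      have "radial (\<lambda>x. ennreal_powr (F (?w * x)) r)"
        unfolding radial_def by (intro allI impI radialD[OF h(1)]) (simp add: padic_abs_mult)
      thus "(\<lambda>x. ennreal_powr (F (?w * x)) r) \<in> borel_measurable \<mu>"
        by (rule borel_measurable_radial[OF _ sets_Haar[OF Haar]])
      show "indicator (padic_ball a l) \<in> borel_measurable \<mu>"
        by (rule borel_measurable_indicator) (simp add: sets_Haar[OF Haar])
    qed
    have "(\<integral>\<^sup>+x\<in>padic_ball a l. ennreal_powr (g n x) r \<partial>\<mu>)
        = (\<integral>\<^sup>+x. ennreal (?b powr r) * (ennreal_powr (F (?w * x)) r * indicator (padic_ball a l) x) \<partial>\<mu>)"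
      using c r by (simp add: g_def ennreal_powr_mult ennreal_powr_ennreal mult.assoc)
    also have "\<dots> = ennreal (?b powr r) * (\<integral>\<^sup>+x\<in>padic_ball a l. ennreal_powr (F (?w * x)) r \<partial>\<mu>)"
      by (rule nn_integral_cmult[OF meas])
    also have "(\<integral>\<^sup>+x\<in>padic_ball a l. ennreal_powr (F (?w * x)) r \<partial>\<mu>)
        = ennreal (P powi int n) * (\<integral>\<^sup>+x\<in>padic_ball (?w * a) (l - int n). ennreal_powr (F x) r \<partial>\<mu>)"
      unfolding P_def by (rule nn_integral_radial_dilate[OF Haar h padic_abs_prime_powi])
    also have "ennreal (?b powr r) * \<dots> \<le> ennreal (?b powr r) * (ennreal (P powi int n)
        * (ennreal (u (l - int n) powr (- r)) * ennreal_powr M r))"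
      by (intro mult_left_mono F_bound) auto
    also have "\<dots> = ennreal (?b powr r * P powi int n * u (l - int n) powr (- r)) * ennreal_powr M r"
      using P by (simp add: ennreal_mult mult.assoc)
    also have "?b powr r * P powi int n * u (l - int n) powr (- r) = d n powr r * u l powr (- r)"
    proof -
      define v where "v = 1 / r"
      have n: "real n = real n * (v * r)" using r by (simp add: v_def)
      have "- (real n * (1 - \<beta>)) * r + real n + of_int (l - int n) * (1 / q - v) * - r
          = - (real n * (1 - \<beta> - 1 / q)) * r + of_int l * (1 / q - v) * - r"
        by (subst (2) n) (simp add: algebra_simps)
      hence "P powr (- (real n * (1 - \<beta>)) * r) * P powr real n * P powr (of_int (l - int n) * (1 / q - v) * - r)
          = P powr (- (real n * (1 - \<beta> - 1 / q)) * r) * P powr (of_int l * (1 / q - v) * - r)"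
        unfolding powr_add[symmetric] by (simp only:)
      thus ?thesis
        unfolding d_def u_def Pk powr_mult powr_powr v_def[symmetric] of_int_of_nat_eq
        by (simp only: mult.assoc)
    qed
    finally show ?thesis by (simp add: ennreal_mult mult.assoc)
  qed
  have "ennreal (u l) * ennreal_powr (\<integral>\<^sup>+x\<in>padic_ball a l. ennreal_powr (Cesaro_mean \<mu> \<beta> (padic_Hardy \<mu> f) x) r \<partial>\<mu>) (1 / r)
      \<le> ennreal (suminf d) * M" for a l
  proof -
    let ?R = "restrict_space \<mu> (padic_ball a l)"
    have ball: "padic_ball a l \<inter> space \<mu> \<in> sets \<mu>" by (simp add: sets_Haar[OF Haar] space_Haar[OF Haar])
    have "(\<integral>\<^sup>+x\<in>padic_ball a l. ennreal_powr (Cesaro_mean \<mu> \<beta> (padic_Hardy \<mu> f) x) r \<partial>\<mu>)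
        \<le> (\<integral>\<^sup>+x\<in>padic_ball a l. ennreal_powr (\<Sum>n. g n x) r \<partial>\<mu>)"
      unfolding g_def F_def c_def P_def
      by (intro nn_integral_mono mult_right_mono ennreal_powr_mono Cesaro_mean_padic_Hardy_le Haar r) simp
    also have "\<dots> = (\<integral>\<^sup>+x. ennreal_powr (\<Sum>n. g n x) r \<partial>?R)"
      by (rule nn_integral_restrict_space[OF ball, symmetric])
    also have "\<dots> \<le> ennreal (suminf d powr r) * (ennreal (u l powr (- r)) * ennreal_powr M r)"
    proof (rule nn_integral_powr_suminf_le[OF d(3,1) assms(2)])
      show "g n \<in> borel_measurable ?R" for n
        by (rule measurable_restrict_space1[OF g_meas])
      show "(\<integral>\<^sup>+x. ennreal_powr (g n x) r \<partial>?R)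
          \<le> ennreal (d n powr r) * (ennreal (u l powr (- r)) * ennreal_powr M r)" for n
        unfolding nn_integral_restrict_space[OF ball] by (rule g_bound)
    qed
    also have "\<dots> = ennreal (u l powr (- r)) * ennreal_powr (ennreal (suminf d) * M) r"
      using suminf_nonneg[OF d(1)] d(3) r
      by (simp add: ennreal_powr_mult ennreal_powr_ennreal less_imp_le mult_ac)
    finally show ?thesis by (simp add: normalized_powr_le_iff u0 r)
  qed
  thus ?thesis
    unfolding d(2) M_def[symmetric] unfolding Cesaro_Morrey_norm_def
    by (auto intro!: SUP_least simp: u)
qed

end
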